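(* Let $\mathcal C$ be a category with coproducts and a terminal object $\mathbf 1$. Consider the functors $\sum\colon\mathsf{Fam}(\mathcal C)\to\mathcal C$, the index functor $\mathsf{Fam}(\mathcal C)\to\mathsf{Set}$, $(c_x)_{x\in X}\mapsto X$, and $-\ast\mathbf 1\colon\mathsf{Set}\to\mathcal C$, together with the natural transformation $\sigma$ whose component $\sigma_{(c_x)_{x\in X}}\colon\sum_{x\in X}c_x\to X\ast\mathbf 1$ is the coproduct over $X$ of the morphisms $c_x\to\mathbf 1$. The resulting lax square $$\begin{array}{ccc}\mathsf{Fam}(\mathcal C)&\xrightarrow{\;\sum\;}&\mathcal C\\ \downarrow&\overset{\sigma}{\Swarrow}&\downarrow{\scriptstyle\mathrm{id}}\\ \mathsf{Set}&\xrightarrow{\;-\ast\mathbf 1\;}&\mathcal C\end{array}$$ is a comma diagram if and only if $\mathcal C$ is extensive.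
   Context: Coproducts are small. $\mathsf{Fam}(\mathcal C)$ is the free coproduct completion: objects are set-indexed families $(c_x)_{x\in X}$ of objects of $\mathcal C$; a morphism $(c_x)_{x\in X}\to(d_y)_{y\in Y}$ is a function $f\colon X\to Y$ with morphisms $c_x\to d_{fx}$, $x\in X$. $\sum$ sends a family to its coproduct. $X\ast\mathbf 1=\sum_{x\in X}\mathbf 1$. $\mathcal C$ is extensive if $\sum\colon\prod_{i\in I}\mathcal C\downarrow X_i\to\mathcal C\downarrow\sum_{i\in I}X_i$ is an equivalence for all families $(X_i)_{i\in I}$ of objects. The square is a comma diagram when the canonical functor induced by $\sigma$ from $\mathsf{Fam}(\mathcal C)$ to the comma category $\mathcal C\downarrow(-\ast\mathbf 1)$ (objects: a set $X$, an object $c$ and a morphism $c\to X\ast\mathbf 1$) is an equivalence. In the diagram, the transformation $\sigma$ (drawn $\Swarrow$) goes from $\mathrm{id}\circ\sum$ to $(-\ast\mathbf 1)\circ(\text{index functor})$. *)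

theory Defs
  imports Main "HOL-Library.FuncSet"
begin

section \<open>Categories, functors, natural transformations\<close>

text \<open>
  Hom-sets are indexed by pairs of objects and need not be disjoint, so identities, composition
  and the action of functors on morphisms take the objects involved as arguments:
  \<open>cmp C a b c g f\<close> is the composite of \<open>f : a \<rightarrow> b\<close> and \<open>g : b \<rightarrow> c\<close>.
\<close>

record ('o, 'm) cat =
  ob :: "'o set"
  hom :: "'o \<Rightarrow> 'o \<Rightarrow> 'm set"
  idn :: "'o \<Rightarrow> 'm"
  cmp :: "'o \<Rightarrow> 'o \<Rightarrow> 'o \<Rightarrow> 'm \<Rightarrow> 'm \<Rightarrow> 'm"

definition category :: "('o, 'm) cat \<Rightarrow> bool" where
  "category C \<longleftrightarrow>
    (\<forall>a\<in>ob C. idn C a \<in> hom C a a) \<and>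
    (\<forall>a\<in>ob C. \<forall>b\<in>ob C. \<forall>c\<in>ob C. \<forall>f\<in>hom C a b. \<forall>g\<in>hom C b c. cmp C a b c g f \<in> hom C a c) \<and>
    (\<forall>a\<in>ob C. \<forall>b\<in>ob C. \<forall>f\<in>hom C a b.
      cmp C a a b f (idn C a) = f \<and> cmp C a b b (idn C b) f = f) \<and>
    (\<forall>a\<in>ob C. \<forall>b\<in>ob C. \<forall>c\<in>ob C. \<forall>d\<in>ob C. \<forall>f\<in>hom C a b. \<forall>g\<in>hom C b c. \<forall>h\<in>hom C c d.
      cmp C a c d h (cmp C a b c g f) = cmp C a b d (cmp C b c d h g) f)"

record ('a, 'f, 'b, 'g) functor_data =
  on_ob :: "'a \<Rightarrow> 'b"
  on_hom :: "'a \<Rightarrow> 'a \<Rightarrow> 'f \<Rightarrow> 'g"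

definition is_functor ::
  "('a, 'f) cat \<Rightarrow> ('b, 'g) cat \<Rightarrow> ('a, 'f, 'b, 'g) functor_data \<Rightarrow> bool" where
  "is_functor A B F \<longleftrightarrow>
    (\<forall>a\<in>ob A. on_ob F a \<in> ob B) \<and>
    (\<forall>a\<in>ob A. \<forall>b\<in>ob A. \<forall>f\<in>hom A a b. on_hom F a b f \<in> hom B (on_ob F a) (on_ob F b)) \<and>
    (\<forall>a\<in>ob A. on_hom F a a (idn A a) = idn B (on_ob F a)) \<and>
    (\<forall>a\<in>ob A. \<forall>b\<in>ob A. \<forall>c\<in>ob A. \<forall>f\<in>hom A a b. \<forall>g\<in>hom A b c.
      on_hom F a c (cmp A a b c g f) =
      cmp B (on_ob F a) (on_ob F b) (on_ob F c) (on_hom F b c g) (on_hom F a b f))"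

definition id_functor :: "('a, 'f, 'a, 'f) functor_data" where
  "id_functor = \<lparr> on_ob = (\<lambda>a. a), on_hom = (\<lambda>_ _ f. f) \<rparr>"

definition comp_functor ::
  "('b, 'g, 'c, 'h) functor_data \<Rightarrow> ('a, 'f, 'b, 'g) functor_data \<Rightarrow> ('a, 'f, 'c, 'h) functor_data"
  where
  "comp_functor G F =
    \<lparr> on_ob = (\<lambda>a. on_ob G (on_ob F a)),
      on_hom = (\<lambda>a b f. on_hom G (on_ob F a) (on_ob F b) (on_hom F a b f)) \<rparr>"

definition natural_transformation ::
  "('a, 'f) cat \<Rightarrow> ('b, 'g) cat \<Rightarrow> ('a, 'f, 'b, 'g) functor_data \<Rightarrow> ('a, 'f, 'b, 'g) functor_data
    \<Rightarrow> ('a \<Rightarrow> 'g) \<Rightarrow> bool" where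
  "natural_transformation A B F G \<tau> \<longleftrightarrow>
    (\<forall>a\<in>ob A. \<tau> a \<in> hom B (on_ob F a) (on_ob G a)) \<and>
    (\<forall>a\<in>ob A. \<forall>b\<in>ob A. \<forall>f\<in>hom A a b.
      cmp B (on_ob F a) (on_ob F b) (on_ob G b) (\<tau> b) (on_hom F a b f) =
      cmp B (on_ob F a) (on_ob G a) (on_ob G b) (on_hom G a b f) (\<tau> a))"

definition isomorphism :: "('o, 'm) cat \<Rightarrow> 'o \<Rightarrow> 'o \<Rightarrow> 'm \<Rightarrow> bool" where
  "isomorphism C a b f \<longleftrightarrow>
    f \<in> hom C a b \<and>
    (\<exists>g\<in>hom C b a. cmp C a b a g f = idn C a \<and> cmp C b a b f g = idn C b)"

definition naturally_isomorphic ::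
  "('a, 'f) cat \<Rightarrow> ('b, 'g) cat \<Rightarrow> ('a, 'f, 'b, 'g) functor_data \<Rightarrow> ('a, 'f, 'b, 'g) functor_data
    \<Rightarrow> bool" where
  "naturally_isomorphic A B F G \<longleftrightarrow>
    (\<exists>\<tau>. natural_transformation A B F G \<tau> \<and>
         (\<forall>a\<in>ob A. isomorphism B (on_ob F a) (on_ob G a) (\<tau> a)))"

definition equivalence ::
  "('a, 'f) cat \<Rightarrow> ('b, 'g) cat \<Rightarrow> ('a, 'f, 'b, 'g) functor_data \<Rightarrow> bool" where
  "equivalence A B F \<longleftrightarrow>
    is_functor A B F \<and>
    (\<exists>G. is_functor B A G \<and>
      naturally_isomorphic A A (comp_functor G F) id_functor \<and>
      naturally_isomorphic B B (comp_functor F G) id_functor)"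


section \<open>Products of categories, slices, comma categories\<close>

definition prod_cat :: "'i set \<Rightarrow> ('i \<Rightarrow> ('o, 'm) cat) \<Rightarrow> ('i \<Rightarrow> 'o, 'i \<Rightarrow> 'm) cat" where
  "prod_cat I A =
    \<lparr> ob = (\<Pi>\<^sub>E i\<in>I. ob (A i)),
      hom = (\<lambda>a b. \<Pi>\<^sub>E i\<in>I. hom (A i) (a i) (b i)),
      idn = (\<lambda>a. \<lambda>i\<in>I. idn (A i) (a i)),
      cmp = (\<lambda>a b c g f. \<lambda>i\<in>I. cmp (A i) (a i) (b i) (c i) (g i) (f i)) \<rparr>"

definition slice :: "('o, 'm) cat \<Rightarrow> 'o \<Rightarrow> ('o \<times> 'm, 'm) cat" where
  "slice C x =
    \<lparr> ob = {(a, p). a \<in> ob C \<and> p \<in> hom C a x},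
      hom = (\<lambda>(a, p) (b, q). {f \<in> hom C a b. cmp C a b x q f = p}),
      idn = (\<lambda>(a, p). idn C a),
      cmp = (\<lambda>(a, p) (b, q) (c, r). cmp C a b c) \<rparr>"

definition comma ::
  "('a, 'f) cat \<Rightarrow> ('b, 'g) cat \<Rightarrow> ('c, 'h) cat
    \<Rightarrow> ('a, 'f, 'c, 'h) functor_data \<Rightarrow> ('b, 'g, 'c, 'h) functor_data
    \<Rightarrow> ('a \<times> 'b \<times> 'h, 'f \<times> 'g) cat" where
  "comma A B C F G =
    \<lparr> ob = {(a, b, h). a \<in> ob A \<and> b \<in> ob B \<and> h \<in> hom C (on_ob F a) (on_ob G b)},
      hom = (\<lambda>(a, b, h) (a', b', h').
        {(f, g). f \<in> hom A a a' \<and> g \<in> hom B b b' \<and>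
          cmp C (on_ob F a) (on_ob F a') (on_ob G b') h' (on_hom F a a' f) =
          cmp C (on_ob F a) (on_ob G b) (on_ob G b') (on_hom G b b' g) h}),
      idn = (\<lambda>(a, b, h). (idn A a, idn B b)),
      cmp = (\<lambda>(a, b, h) (a', b', h') (a'', b'', h'') (f', g') (f, g).
        (cmp A a a' a'' f' f, cmp B b b' b'' g' g)) \<rparr>"

text \<open>
  A lax square with top \<open>P : E \<rightarrow> A\<close>, left side \<open>Q : E \<rightarrow> B\<close>, right side \<open>F : A \<rightarrow> C\<close>,
  bottom \<open>G : B \<rightarrow> C\<close> and 2-cell \<open>\<sigma> : F P \<Rightarrow> G Q\<close>.
\<close>

definition lax_square ::
  "('e, 'k) cat \<Rightarrow> ('a, 'f) cat \<Rightarrow> ('b, 'g) cat \<Rightarrow> ('c, 'h) cat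
    \<Rightarrow> ('e, 'k, 'a, 'f) functor_data \<Rightarrow> ('e, 'k, 'b, 'g) functor_data
    \<Rightarrow> ('a, 'f, 'c, 'h) functor_data \<Rightarrow> ('b, 'g, 'c, 'h) functor_data \<Rightarrow> ('e \<Rightarrow> 'h) \<Rightarrow> bool" where
  "lax_square E A B C P Q F G \<sigma> \<longleftrightarrow>
    is_functor E A P \<and> is_functor E B Q \<and> is_functor A C F \<and> is_functor B C G \<and>
    natural_transformation E C (comp_functor F P) (comp_functor G Q) \<sigma>"

definition comma_functor ::
  "('e, 'k, 'a, 'f) functor_data \<Rightarrow> ('e, 'k, 'b, 'g) functor_data \<Rightarrow> ('e \<Rightarrow> 'h)
    \<Rightarrow> ('e, 'k, 'a \<times> 'b \<times> 'h, 'f \<times> 'g) functor_data" where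
  "comma_functor P Q \<sigma> =
    \<lparr> on_ob = (\<lambda>e. (on_ob P e, on_ob Q e, \<sigma> e)),
      on_hom = (\<lambda>e e' k. (on_hom P e e' k, on_hom Q e e' k)) \<rparr>"

definition comma_diagram ::
  "('e, 'k) cat \<Rightarrow> ('a, 'f) cat \<Rightarrow> ('b, 'g) cat \<Rightarrow> ('c, 'h) cat
    \<Rightarrow> ('e, 'k, 'a, 'f) functor_data \<Rightarrow> ('e, 'k, 'b, 'g) functor_data
    \<Rightarrow> ('a, 'f, 'c, 'h) functor_data \<Rightarrow> ('b, 'g, 'c, 'h) functor_data \<Rightarrow> ('e \<Rightarrow> 'h) \<Rightarrow> bool" where
  "comma_diagram E A B C P Q F G \<sigma> \<longleftrightarrow>
    lax_square E A B C P Q F G \<sigma> \<and>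
    equivalence E (comma A B C F G) (comma_functor P Q \<sigma>)"


section \<open>Small sets\<close>

text \<open>
  HOL has no class of all small sets, so \<open>U\<close> collects the sets over an index type \<open>'i\<close> that count
  as small. Every Grothendieck universe gives an instance; closure under power sets and the
  presence of an infinite set are not demanded.
\<close>

definition small_universe :: "'i set set \<Rightarrow> bool" where
  "small_universe U \<longleftrightarrow>
    (\<forall>x y. {x, y} \<in> U) \<and>
    (\<forall>X\<in>U. \<forall>Y. Y \<subseteq> X \<longrightarrow> Y \<in> U) \<and>
    (\<forall>X\<in>U. \<forall>f. f ` X \<in> U) \<and>
    (\<forall>X\<in>U. \<forall>F. (\<forall>x\<in>X. F x \<in> U) \<longrightarrow> (\<Union>x\<in>X. F x) \<in> U)"

definition set_cat :: "'i set set \<Rightarrow> ('i set, 'i \<Rightarrow> 'i) cat" where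
  "set_cat U =
    \<lparr> ob = U,
      hom = (\<lambda>X Y. X \<rightarrow>\<^sub>E Y),
      idn = (\<lambda>X. \<lambda>x\<in>X. x),
      cmp = (\<lambda>X Y Z g f. compose X g f) \<rparr>"


section \<open>Terminal objects and chosen coproducts\<close>

definition terminal :: "('o, 'm) cat \<Rightarrow> 'o \<Rightarrow> bool" where
  "terminal C t \<longleftrightarrow> t \<in> ob C \<and> (\<forall>a\<in>ob C. \<exists>!f. f \<in> hom C a t)"

definition to_terminal :: "('o, 'm) cat \<Rightarrow> 'o \<Rightarrow> 'o \<Rightarrow> 'm" where
  "to_terminal C t a = (THE f. f \<in> hom C a t)"

definition is_coproduct ::
  "('o, 'm) cat \<Rightarrow> 'i set \<Rightarrow> ('i \<Rightarrow> 'o) \<Rightarrow> 'o \<Rightarrow> ('i \<Rightarrow> 'm) \<Rightarrow> bool" where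
  "is_coproduct C X c s \<iota> \<longleftrightarrow>
    s \<in> ob C \<and> (\<forall>x\<in>X. \<iota> x \<in> hom C (c x) s) \<and>
    (\<forall>z\<in>ob C. \<forall>\<phi>. (\<forall>x\<in>X. \<phi> x \<in> hom C (c x) z) \<longrightarrow>
      (\<exists>!u. u \<in> hom C s z \<and> (\<forall>x\<in>X. cmp C (c x) s z u (\<iota> x) = \<phi> x)))"

text \<open>
  The functor \<open>\<Sum>\<close> presupposes a choice of coproducts; \<open>csum K X c\<close> and \<open>incl K X c\<close> are the
  chosen coproduct of the family \<open>(c x)\<close>, \<open>x \<in> X\<close>, and its coprojections.
\<close>

record ('i, 'o, 'm) coproduct_choice =
  csum :: "'i set \<Rightarrow> ('i \<Rightarrow> 'o) \<Rightarrow> 'o"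
  incl :: "'i set \<Rightarrow> ('i \<Rightarrow> 'o) \<Rightarrow> 'i \<Rightarrow> 'm"

definition has_coproducts ::
  "('o, 'm) cat \<Rightarrow> 'i set set \<Rightarrow> ('i, 'o, 'm) coproduct_choice \<Rightarrow> bool" where
  "has_coproducts C U K \<longleftrightarrow>
    (\<forall>X\<in>U. \<forall>c\<in>X \<rightarrow>\<^sub>E ob C. is_coproduct C X c (csum K X c) (incl K X c))"

definition cotuple ::
  "('o, 'm) cat \<Rightarrow> ('i, 'o, 'm) coproduct_choice \<Rightarrow> 'i set \<Rightarrow> ('i \<Rightarrow> 'o) \<Rightarrow> 'o \<Rightarrow> ('i \<Rightarrow> 'm) \<Rightarrow> 'm" where
  "cotuple C K X c z \<phi> =
    (THE u. u \<in> hom C (csum K X c) z \<and>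
      (\<forall>x\<in>X. cmp C (c x) (csum K X c) z u (incl K X c x) = \<phi> x))"


section \<open>The free coproduct completion and the square\<close>

definition Fam :: "('o, 'm) cat \<Rightarrow> 'i set set \<Rightarrow> ('i set \<times> ('i \<Rightarrow> 'o), ('i \<Rightarrow> 'i) \<times> ('i \<Rightarrow> 'm)) cat" where
  "Fam C U =
    \<lparr> ob = {(X, c). X \<in> U \<and> c \<in> X \<rightarrow>\<^sub>E ob C},
      hom = (\<lambda>(X, c) (Y, d).
        {(f, \<phi>). f \<in> X \<rightarrow>\<^sub>E Y \<and> \<phi> \<in> (\<Pi>\<^sub>E x\<in>X. hom C (c x) (d (f x)))}),
      idn = (\<lambda>(X, c). (\<lambda>x\<in>X. x, \<lambda>x\<in>X. idn C (c x))),
      cmp = (\<lambda>(X, c) (Y, d) (Z, e) (g, \<psi>) (f, \<phi>).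
        (compose X g f, \<lambda>x\<in>X. cmp C (c x) (d (f x)) (e (g (f x))) (\<psi> (f x)) (\<phi> x))) \<rparr>"

definition sum_functor ::
  "('o, 'm) cat \<Rightarrow> ('i, 'o, 'm) coproduct_choice
    \<Rightarrow> ('i set \<times> ('i \<Rightarrow> 'o), ('i \<Rightarrow> 'i) \<times> ('i \<Rightarrow> 'm), 'o, 'm) functor_data" where
  "sum_functor C K =
    \<lparr> on_ob = (\<lambda>(X, c). csum K X c),
      on_hom = (\<lambda>(X, c) (Y, d) (f, \<phi>).
        cotuple C K X c (csum K Y d)
          (\<lambda>x. cmp C (c x) (d (f x)) (csum K Y d) (incl K Y d (f x)) (\<phi> x))) \<rparr>"

definition index_functor ::
  "('i set \<times> ('i \<Rightarrow> 'o), ('i \<Rightarrow> 'i) \<times> ('i \<Rightarrow> 'm), 'i set, 'i \<Rightarrow> 'i) functor_data" where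
  "index_functor = \<lparr> on_ob = fst, on_hom = (\<lambda>_ _. fst) \<rparr>"

definition copower_functor ::
  "('o, 'm) cat \<Rightarrow> ('i, 'o, 'm) coproduct_choice \<Rightarrow> 'o
    \<Rightarrow> ('i set, 'i \<Rightarrow> 'i, 'o, 'm) functor_data" where
  "copower_functor C K t =
    \<lparr> on_ob = (\<lambda>X. csum K X (\<lambda>x\<in>X. t)),
      on_hom = (\<lambda>X Y f.
        cotuple C K X (\<lambda>x\<in>X. t) (csum K Y (\<lambda>y\<in>Y. t)) (\<lambda>x. incl K Y (\<lambda>y\<in>Y. t) (f x))) \<rparr>"

definition sum_hom ::
  "('o, 'm) cat \<Rightarrow> ('i, 'o, 'm) coproduct_choice
    \<Rightarrow> 'i set \<Rightarrow> ('i \<Rightarrow> 'o) \<Rightarrow> ('i \<Rightarrow> 'o) \<Rightarrow> ('i \<Rightarrow> 'm) \<Rightarrow> 'm" where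
  "sum_hom C K X c d \<phi> = on_hom (sum_functor C K) (X, c) (X, d) (\<lambda>x\<in>X. x, \<phi>)"

definition sigma ::
  "('o, 'm) cat \<Rightarrow> ('i, 'o, 'm) coproduct_choice \<Rightarrow> 'o \<Rightarrow> 'i set \<times> ('i \<Rightarrow> 'o) \<Rightarrow> 'm" where
  "sigma C K t = (\<lambda>(X, c). sum_hom C K X c (\<lambda>x\<in>X. t) (\<lambda>x\<in>X. to_terminal C t (c x)))"


section \<open>Extensive categories\<close>

definition slice_sum ::
  "('o, 'm) cat \<Rightarrow> ('i, 'o, 'm) coproduct_choice \<Rightarrow> 'i set \<Rightarrow> ('i \<Rightarrow> 'o)
    \<Rightarrow> ('i \<Rightarrow> 'o \<times> 'm, 'i \<Rightarrow> 'm, 'o \<times> 'm, 'm) functor_data" where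
  "slice_sum C K I X =
    \<lparr> on_ob = (\<lambda>A. (csum K I (\<lambda>i\<in>I. fst (A i)),
        sum_hom C K I (\<lambda>i\<in>I. fst (A i)) X (\<lambda>i\<in>I. snd (A i)))),
      on_hom = (\<lambda>A B. sum_hom C K I (\<lambda>i\<in>I. fst (A i)) (\<lambda>i\<in>I. fst (B i))) \<rparr>"

definition extensive ::
  "('o, 'm) cat \<Rightarrow> 'i set set \<Rightarrow> ('i, 'o, 'm) coproduct_choice \<Rightarrow> bool" where
  "extensive C U K \<longleftrightarrow>
    (\<forall>I\<in>U. \<forall>X\<in>I \<rightarrow>\<^sub>E ob C.
      equivalence (prod_cat I (\<lambda>i. slice C (X i))) (slice C (csum K I X)) (slice_sum C K I X))"

end

theory Submission imports Defs begin

text \<open>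
  Both conditions turn out to say the same two things about \<open>C\<close>: for every family \<open>d\<close> over \<open>Y\<close>
  the square formed by \<open>d y \<rightarrow> \<Sum>d \<rightarrow> Y * 1\<close> and the coprojection \<open>1 \<rightarrow> Y * 1\<close> at \<open>y\<close> is a pullback,
  and every \<open>a \<rightarrow> X * 1\<close> is isomorphic to some \<open>\<sigma> : \<Sum>c \<rightarrow> X * 1\<close>. The first is full
  faithfulness, since a morphism out of a coproduct is determined summand by summand; the second is
  essential surjectivity. For extensivity the case \<open>X\<^sub>i = 1\<close> suffices: a morphism \<open>a \<rightarrow> \<Sum>X\<close> is
  decomposed over \<open>I * 1\<close>, and the pullback property makes it a coproduct of morphisms into the \<open>X\<^sub>i\<close>.
\<close>

section \<open>Equivalences are the fully faithful, essentially surjective functors\<close>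

text \<open>When all \<open>X i\<close> are terminal, the two comparisons are closely related: a
  slice over the terminal object is \<open>C\<close> up to isomorphism, so the product of the slices
  is the fibre of \<open>Fam\<close> over \<open>I\<close>, and the slice over \<open>I * 1\<close>
  is the fibre of the comma category over \<open>I\<close>. Two differences remain. Morphisms of the
  comma category carry an arbitrary index function \<open>f\<close>, while in the slices the index
  is fixed; and an isomorphism in the comma category may move the index set along a bijection, while
  in the slices it may not. The elementary conditions are neutral between the two: the pullback
  property concerns one index \<open>y\<close> at a time, so it can be read at
  \<open>y = f x\<close> for any \<open>f\<close>, and the decomposition keeps the index set
  \<open>X\<close>. The pullback property is recovered from the square through one-object families,
  and from extensivity through families padded by an initial object. Since equivalences are defined
  by quasi-inverses, they are first replaced by full faithfulness and essential surjectivity, which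
  speak directly about morphisms and objects of \<open>C\<close>.\<close>

lemma id_in_hom: "category C \<Longrightarrow> a \<in> ob C \<Longrightarrow> idn C a \<in> hom C a a"
  unfolding category_def by blast

lemma comp_in_hom:
  "category C \<Longrightarrow> a \<in> ob C \<Longrightarrow> b \<in> ob C \<Longrightarrow> c \<in> ob C \<Longrightarrow> f \<in> hom C a b \<Longrightarrow> g \<in> hom C b c
    \<Longrightarrow> cmp C a b c g f \<in> hom C a c"
  unfolding category_def by blast

lemma comp_id_right:
  "category C \<Longrightarrow> a \<in> ob C \<Longrightarrow> b \<in> ob C \<Longrightarrow> f \<in> hom C a b \<Longrightarrow> cmp C a a b f (idn C a) = f"
  unfolding category_def by blast

lemma comp_id_left:
  "category C \<Longrightarrow> a \<in> ob C \<Longrightarrow> b \<in> ob C \<Longrightarrow> f \<in> hom C a b \<Longrightarrow> cmp C a b b (idn C b) f = f"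
  unfolding category_def by blast

lemma comp_assoc:
  "category C \<Longrightarrow> a \<in> ob C \<Longrightarrow> b \<in> ob C \<Longrightarrow> c \<in> ob C \<Longrightarrow> d \<in> ob C
    \<Longrightarrow> f \<in> hom C a b \<Longrightarrow> g \<in> hom C b c \<Longrightarrow> h \<in> hom C c d
    \<Longrightarrow> cmp C a c d h (cmp C a b c g f) = cmp C a b d (cmp C b c d h g) f"
  unfolding category_def by blast

lemma functor_ob: "is_functor A B F \<Longrightarrow> a \<in> ob A \<Longrightarrow> on_ob F a \<in> ob B"
  unfolding is_functor_def by blast

lemma functor_hom:
  "is_functor A B F \<Longrightarrow> a \<in> ob A \<Longrightarrow> b \<in> ob A \<Longrightarrow> f \<in> hom A a b
    \<Longrightarrow> on_hom F a b f \<in> hom B (on_ob F a) (on_ob F b)"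
  unfolding is_functor_def by blast

lemma functor_id: "is_functor A B F \<Longrightarrow> a \<in> ob A \<Longrightarrow> on_hom F a a (idn A a) = idn B (on_ob F a)"
  unfolding is_functor_def by blast

lemma functor_comp:
  "is_functor A B F \<Longrightarrow> a \<in> ob A \<Longrightarrow> b \<in> ob A \<Longrightarrow> c \<in> ob A \<Longrightarrow> f \<in> hom A a b \<Longrightarrow> g \<in> hom A b c
    \<Longrightarrow> on_hom F a c (cmp A a b c g f) =
      cmp B (on_ob F a) (on_ob F b) (on_ob F c) (on_hom F b c g) (on_hom F a b f)"
  unfolding is_functor_def by blast

lemma isomorphism_in_hom: "isomorphism C a b f \<Longrightarrow> f \<in> hom C a b"
  unfolding isomorphism_def by blast

lemma isomorphism_comp:
  assumes C: "category C" and ob: "a \<in> ob C" "b \<in> ob C" "c \<in> ob C"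
    and f: "isomorphism C a b f" and g: "isomorphism C b c g"
  shows "isomorphism C a c (cmp C a b c g f)"
proof -
  from f obtain f' where f': "f \<in> hom C a b" "f' \<in> hom C b a"
    "cmp C a b a f' f = idn C a" "cmp C b a b f f' = idn C b"
    unfolding isomorphism_def by blast
  from g obtain g' where g': "g \<in> hom C b c" "g' \<in> hom C c b"
    "cmp C b c b g' g = idn C b" "cmp C c b c g g' = idn C c"
    unfolding isomorphism_def by blast
  note [simp] = ob f' g' comp_in_hom[OF C] id_in_hom[OF C] comp_id_left[OF C] comp_id_right[OF C]
  have "cmp C a c a (cmp C c b a f' g') (cmp C a b c g f)
      = cmp C a b a (cmp C b c a (cmp C c b a f' g') g) f"
    by (simp add: comp_assoc[OF C, of a b c])
  also have "cmp C b c a (cmp C c b a f' g') g = f'"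
    by (simp add: comp_assoc[OF C, of b c b a, symmetric])
  finally have 1: "cmp C a c a (cmp C c b a f' g') (cmp C a b c g f) = idn C a" by simp
  have "cmp C c a c (cmp C a b c g f) (cmp C c b a f' g')
      = cmp C c b c (cmp C b a c (cmp C a b c g f) f') g'"
    by (simp add: comp_assoc[OF C, of c b a c])
  also have "cmp C b a c (cmp C a b c g f) f' = g"
    by (simp add: comp_assoc[OF C, of b a b c, symmetric])
  finally have 2: "cmp C c a c (cmp C a b c g f) (cmp C c b a f' g') = idn C c" by simp
  show ?thesis
    unfolding isomorphism_def by (intro conjI bexI[of _ "cmp C c b a f' g'"] 1 2) simp_all
qed

lemma isomorphism_functor:
  assumes F: "is_functor A B F" and ob: "a \<in> ob A" "b \<in> ob A" and f: "isomorphism A a b f"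
  shows "isomorphism B (on_ob F a) (on_ob F b) (on_hom F a b f)"
proof -
  from f obtain f' where f': "f \<in> hom A a b" "f' \<in> hom A b a"
    "cmp A a b a f' f = idn A a" "cmp A b a b f f' = idn A b"
    unfolding isomorphism_def by blast
  show ?thesis
    unfolding isomorphism_def
    by (intro conjI bexI[of _ "on_hom F b a f'"])
      (simp_all add: ob f' functor_hom[OF F] functor_id[OF F] flip: functor_comp[OF F])
qed

lemma isomorphism_cancel_right:
  assumes C: "category C" and ob: "a \<in> ob C" "b \<in> ob C" "c \<in> ob C"
    and e: "isomorphism C a b e" and g: "g \<in> hom C b c" "h \<in> hom C b c"
    and eq: "cmp C a b c g e = cmp C a b c h e"
  shows "g = h"
proof -
  from e obtain e' where e': "e \<in> hom C a b" "e' \<in> hom C b a" "cmp C b a b e e' = idn C b"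
    unfolding isomorphism_def by blast
  have "cmp C b a c (cmp C a b c k e) e' = k" if "k \<in> hom C b c" for k
    using that ob e' by (simp add: comp_assoc[OF C, symmetric] comp_id_right[OF C])
  with eq g show ?thesis by metis
qed

lemma isomorphism_cancel_left:
  assumes C: "category C" and ob: "a \<in> ob C" "b \<in> ob C" "c \<in> ob C"
    and e: "isomorphism C b c e" and g: "g \<in> hom C a b" "h \<in> hom C a b"
    and eq: "cmp C a b c e g = cmp C a b c e h"
  shows "g = h"
proof -
  from e obtain e' where e': "e \<in> hom C b c" "e' \<in> hom C c b" "cmp C b c b e' e = idn C b"
    unfolding isomorphism_def by blast
  have "cmp C a c b e' (cmp C a b c e k) = k" if "k \<in> hom C a b" for k
    using that ob e' by (simp add: comp_assoc[OF C] comp_id_left[OF C])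
  with eq g show ?thesis by metis
qed

text \<open>Existence and uniqueness of preimages form one formula, so that a preimage can be picked
  by \<open>THE\<close> and faithfulness is the uniqueness part.\<close>

definition fully_faithful ::
  "('a, 'f) cat \<Rightarrow> ('b, 'g) cat \<Rightarrow> ('a, 'f, 'b, 'g) functor_data \<Rightarrow> bool" where
  "fully_faithful A B F \<longleftrightarrow>
    (\<forall>a\<in>ob A. \<forall>b\<in>ob A. \<forall>h\<in>hom B (on_ob F a) (on_ob F b). \<exists>!f. f \<in> hom A a b \<and> on_hom F a b f = h)"

definition essentially_surjective ::
  "('a, 'f) cat \<Rightarrow> ('b, 'g) cat \<Rightarrow> ('a, 'f, 'b, 'g) functor_data \<Rightarrow> bool" where
  "essentially_surjective A B F \<longleftrightarrow> (\<forall>b\<in>ob B. \<exists>a\<in>ob A. \<exists>e. isomorphism B (on_ob F a) b e)"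

text \<open>By naturality of the isomorphism \<open>\<eta>\<close>, the composite of
  \<open>\<eta> a\<close> and \<open>f\<close> depends only on the image of \<open>f\<close> under
  \<open>F\<close>, and \<open>\<eta> a\<close> can be cancelled. A one-sided natural isomorphism is
  assumed so that the lemma serves for \<open>F\<close> and, with the roles exchanged, for the
  quasi-inverse \<open>G\<close>.\<close>

lemma left_inverse_faithful:
  assumes A: "category A" and F: "is_functor A B F" and G: "is_functor B A G"
    and iso: "naturally_isomorphic A A (comp_functor G F) id_functor"
    and ob: "a \<in> ob A" "b \<in> ob A" and f: "f \<in> hom A a b" "g \<in> hom A a b"
    and eq: "on_hom F a b f = on_hom F a b g"
  shows "f = g"
proof -
  from iso obtain \<eta> where
    nat: "\<And>f. f \<in> hom A a b \<Longrightarrow>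
        cmp A (on_ob G (on_ob F a)) (on_ob G (on_ob F b)) b (\<eta> b) (on_hom G (on_ob F a) (on_ob F b) (on_hom F a b f))
        = cmp A (on_ob G (on_ob F a)) a b f (\<eta> a)"
    and \<eta>: "isomorphism A (on_ob G (on_ob F a)) a (\<eta> a)"
    unfolding naturally_isomorphic_def natural_transformation_def comp_functor_def id_functor_def
    using ob by (simp, blast)
  show ?thesis
    by (rule isomorphism_cancel_right[OF A _ _ _ \<eta>])
      (use ob f nat[of f] nat[of g] eq functor_ob[OF G] functor_ob[OF F] in auto)
qed

lemma equivalence_fully_faithful:
  assumes A: "category A" and B: "category B" and eqv: "equivalence A B F"
  shows "fully_faithful A B F"
  unfolding fully_faithful_def
proof (intro ballI)
  fix a b h
  assume ob: "a \<in> ob A" "b \<in> ob A" and h: "h \<in> hom B (on_ob F a) (on_ob F b)"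
  from eqv obtain G where F: "is_functor A B F" and G: "is_functor B A G"
    and GF: "naturally_isomorphic A A (comp_functor G F) id_functor"
    and FG: "naturally_isomorphic B B (comp_functor F G) id_functor"
    unfolding equivalence_def by blast
  let ?GF = "\<lambda>x. on_ob G (on_ob F x)" and ?Gh = "on_hom G (on_ob F a) (on_ob F b)"
  from GF obtain \<eta> where
    nat: "\<And>f. f \<in> hom A a b \<Longrightarrow>
        cmp A (?GF a) (?GF b) b (\<eta> b) (?Gh (on_hom F a b f)) = cmp A (?GF a) a b f (\<eta> a)"
    and \<eta>: "\<And>x. x \<in> ob A \<Longrightarrow> isomorphism A (?GF x) x (\<eta> x)"
    unfolding naturally_isomorphic_def natural_transformation_def comp_functor_def id_functor_def
    using ob by (simp, blast)
  have Fob: "on_ob F a \<in> ob B" "on_ob F b \<in> ob B" using ob functor_ob[OF F] by auto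
  have GFob: "?GF a \<in> ob A" "?GF b \<in> ob A" using Fob functor_ob[OF G] by auto
  have Gh: "?Gh h \<in> hom A (?GF a) (?GF b)" using functor_hom[OF G Fob h] .
  obtain \<eta>' where \<eta>': "\<eta>' \<in> hom A a (?GF a)" "cmp A (?GF a) a (?GF a) \<eta>' (\<eta> a) = idn A (?GF a)"
    using \<eta>[OF ob(1)] unfolding isomorphism_def by blast
  note \<eta>h = isomorphism_in_hom[OF \<eta>]
  \<comment> \<open>Naturality of \<open>\<eta>\<close> forces this value if \<open>F\<close> is to
    send \<open>f\<close> to \<open>h\<close>: it is the image of \<open>h\<close> under
    \<open>G\<close>, conjugated by \<open>\<eta>\<close>.\<close>
  define f where "f = cmp A a (?GF a) b (cmp A (?GF a) (?GF b) b (\<eta> b) (?Gh h)) \<eta>'"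
  have f: "f \<in> hom A a b"
    unfolding f_def using ob GFob Gh \<eta>' \<eta>h by (simp add: comp_in_hom[OF A])
  have "cmp A (?GF a) a b f (\<eta> a) = cmp A (?GF a) (?GF b) b (\<eta> b) (?Gh h)"
    unfolding f_def using ob GFob Gh \<eta>' \<eta>h
    by (simp add: comp_assoc[OF A, symmetric] comp_id_right[OF A] comp_in_hom[OF A])
  with nat[OF f] have
    "cmp A (?GF a) (?GF b) b (\<eta> b) (?Gh (on_hom F a b f)) = cmp A (?GF a) (?GF b) b (\<eta> b) (?Gh h)"
    by simp
  \<comment> \<open>\<open>\<eta> b\<close> is cancelled on the left. Fullness of \<open>F\<close>
    then follows from faithfulness of \<open>G\<close>, which comes from the other natural
    isomorphism.\<close>
  then have "?Gh (on_hom F a b f) = ?Gh h"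
    by (rule isomorphism_cancel_left[OF A GFob(1) GFob(2) ob(2) \<eta>[OF ob(2)]
          functor_hom[OF G Fob functor_hom[OF F ob f]] Gh])
  then have "on_hom F a b f = h"
    by (rule left_inverse_faithful[OF B G F FG Fob functor_hom[OF F ob f] h])
  with f show "\<exists>!f. f \<in> hom A a b \<and> on_hom F a b f = h"
    using left_inverse_faithful[OF A F G GF ob] by blast
qed

lemma equivalence_essentially_surjective:
  "equivalence A B F \<Longrightarrow> essentially_surjective A B F"
  unfolding equivalence_def essentially_surjective_def naturally_isomorphic_def
    comp_functor_def id_functor_def
  by (fastforce dest: functor_ob)

text \<open>The quasi-inverse chooses for each \<open>b\<close> an object \<open>g b\<close> and an
  isomorphism \<open>e b : F (g b) \<rightarrow> b\<close>, and acts on morphisms so that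
  \<open>e\<close> becomes natural. Equations between morphisms of \<open>A\<close> are checked
  after applying \<open>F\<close>, by faithfulness.\<close>

lemma equivalence_intro:
  assumes A: "category A" and B: "category B" and F: "is_functor A B F"
    and ff: "fully_faithful A B F" and es: "essentially_surjective A B F"
  shows "equivalence A B F"
proof -
  from es have "\<forall>b\<in>ob B. \<exists>a e e'. a \<in> ob A \<and> e \<in> hom B (on_ob F a) b \<and> e' \<in> hom B b (on_ob F a) \<and>
      cmp B (on_ob F a) b (on_ob F a) e' e = idn B (on_ob F a) \<and> cmp B b (on_ob F a) b e e' = idn B b"
    unfolding essentially_surjective_def isomorphism_def by blast
  then obtain g e e' where g: "\<And>b. b \<in> ob B \<Longrightarrow> g b \<in> ob A"
    and e: "\<And>b. b \<in> ob B \<Longrightarrow> e b \<in> hom B (on_ob F (g b)) b"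
    and e': "\<And>b. b \<in> ob B \<Longrightarrow> e' b \<in> hom B b (on_ob F (g b))"
    and e'e: "\<And>b. b \<in> ob B \<Longrightarrow> cmp B (on_ob F (g b)) b (on_ob F (g b)) (e' b) (e b) = idn B (on_ob F (g b))"
    and ee': "\<And>b. b \<in> ob B \<Longrightarrow> cmp B b (on_ob F (g b)) b (e b) (e' b) = idn B b"
    by metis
  define pre where "pre a b h = (THE f. f \<in> hom A a b \<and> on_hom F a b f = h)" for a b h
  have pre: "pre a b h \<in> hom A a b \<and> on_hom F a b (pre a b h) = h"
    if "a \<in> ob A" "b \<in> ob A" "h \<in> hom B (on_ob F a) (on_ob F b)" for a b h
    unfolding pre_def
    by (rule theI') (use ff that in \<open>auto simp: fully_faithful_def\<close>)
  have faithful: "f = f'" if "on_hom F a b f = on_hom F a b f'" "a \<in> ob A" "b \<in> ob A"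
    "f \<in> hom A a b" "f' \<in> hom A a b" for a b f f'
    using ff that functor_hom[OF F] unfolding fully_faithful_def by blast
  let ?Fg = "\<lambda>b. on_ob F (g b)"
  have Fg: "b \<in> ob B \<Longrightarrow> ?Fg b \<in> ob B" for b using g functor_ob[OF F] by blast
  \<comment> \<open>\<open>k b c h\<close> is \<open>h\<close> transported to the chosen objects by
    conjugation with \<open>e\<close>. It will be the image under \<open>F\<close> of the value of
    \<open>G\<close> at \<open>h\<close>, and the equation \<open>ek\<close> below is then
    naturality of \<open>e\<close>.\<close>
  define k where "k b c h = cmp B (?Fg b) c (?Fg c) (e' c) (cmp B (?Fg b) b c h (e b))" for b c h
  have k: "k b c h \<in> hom B (?Fg b) (?Fg c)" if "b \<in> ob B" "c \<in> ob B" "h \<in> hom B b c" for b c h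
    unfolding k_def using that Fg e e' by (simp add: comp_in_hom[OF B])
  have ek: "cmp B (?Fg b) (?Fg c) c (e c) (k b c h) = cmp B (?Fg b) b c h (e b)"
    if "b \<in> ob B" "c \<in> ob B" "h \<in> hom B b c" for b c h
    unfolding k_def using that Fg e e' ee'
    by (simp add: comp_in_hom[OF B] comp_assoc[OF B, of "?Fg b" c "?Fg c" c] comp_id_left[OF B])
  have kid: "k b b (idn B b) = idn B (?Fg b)" if "b \<in> ob B" for b
    unfolding k_def using that Fg e e' e'e by (simp add: comp_id_left[OF B])
  have kcomp: "k b d (cmp B b c d h' h) = cmp B (?Fg b) (?Fg c) (?Fg d) (k c d h') (k b c h)"
    if ob: "b \<in> ob B" "c \<in> ob B" "d \<in> ob B" and h: "h \<in> hom B b c" "h' \<in> hom B c d" for b c d h h'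
  proof -
    have "cmp B (?Fg b) (?Fg c) (?Fg d) (k c d h') (k b c h)
        = cmp B (?Fg b) d (?Fg d) (e' d) (cmp B (?Fg b) (?Fg c) d (cmp B (?Fg c) c d h' (e c)) (k b c h))"
      unfolding k_def[of c d] using ob h Fg e e' k
      by (simp add: comp_in_hom[OF B] comp_assoc[OF B, of "?Fg b" "?Fg c" d])
    also have "cmp B (?Fg b) (?Fg c) d (cmp B (?Fg c) c d h' (e c)) (k b c h)
        = cmp B (?Fg b) c d h' (cmp B (?Fg b) b c h (e b))"
      using ob h Fg e k by (simp add: comp_assoc[OF B, symmetric] ek)
    also have "\<dots> = cmp B (?Fg b) b d (cmp B b c d h' h) (e b)"
      using ob h Fg e by (simp add: comp_assoc[OF B])
    finally show ?thesis by (simp add: k_def)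
  qed
  define G where "G = \<lparr> on_ob = g, on_hom = (\<lambda>b c h. pre (g b) (g c) (k b c h)) \<rparr>"
  have G: "is_functor B A G"
    unfolding is_functor_def
  proof (intro conjI ballI)
    fix b assume b: "b \<in> ob B"
    show "on_ob G b \<in> ob A" using b g by (simp add: G_def)
    show "on_hom G b b (idn B b) = idn A (on_ob G b)"
      unfolding G_def using b g[OF b] pre[OF g g k, of b b "idn B b"]
      by (intro faithful[of "g b" "g b"]) (simp_all add: kid id_in_hom[OF A] id_in_hom[OF B] functor_id[OF F])
  next
    fix b c h assume "b \<in> ob B" "c \<in> ob B" "h \<in> hom B b c"
    then show "on_hom G b c h \<in> hom A (on_ob G b) (on_ob G c)"
      using pre g k by (simp add: G_def)
  next
    fix b c d h h'
    assume ob: "b \<in> ob B" "c \<in> ob B" "d \<in> ob B" and h: "h \<in> hom B b c" "h' \<in> hom B c d"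
    show "on_hom G b d (cmp B b c d h' h) =
        cmp A (on_ob G b) (on_ob G c) (on_ob G d) (on_hom G c d h') (on_hom G b c h)"
      unfolding G_def using ob h g Fg pre k comp_in_hom[OF B ob h]
      by (intro faithful[of "g b" "g d"])
        (simp_all add: kcomp comp_in_hom[OF A] comp_in_hom[OF B] functor_comp[OF F, of _ "g c"])
  qed
  have "naturally_isomorphic B B (comp_functor F G) id_functor"
    unfolding naturally_isomorphic_def natural_transformation_def isomorphism_def
  proof (intro exI[of _ e] conjI ballI)
    fix b c h assume "b \<in> ob B" "c \<in> ob B" "h \<in> hom B b c"
    then show "cmp B (on_ob (comp_functor F G) b) (on_ob (comp_functor F G) c) (on_ob id_functor c) (e c)
          (on_hom (comp_functor F G) b c h) =
        cmp B (on_ob (comp_functor F G) b) (on_ob id_functor b) (on_ob id_functor c)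
          (on_hom id_functor b c h) (e b)"
      using pre g k ek by (simp add: comp_functor_def id_functor_def G_def)
  next
    fix b assume b: "b \<in> ob B"
    show "e b \<in> hom B (on_ob (comp_functor F G) b) (on_ob id_functor b)"
      using b e by (simp add: comp_functor_def id_functor_def G_def)
    then show "e b \<in> hom B (on_ob (comp_functor F G) b) (on_ob id_functor b)" .
    show "\<exists>f\<in>hom B (on_ob id_functor b) (on_ob (comp_functor F G) b).
        cmp B (on_ob (comp_functor F G) b) (on_ob id_functor b) (on_ob (comp_functor F G) b) f (e b) =
          idn B (on_ob (comp_functor F G) b) \<and>
        cmp B (on_ob id_functor b) (on_ob (comp_functor F G) b) (on_ob id_functor b) (e b) f =
          idn B (on_ob id_functor b)"
      using b e' e'e ee'
      by (intro bexI[of _ "e' b"]) (simp_all add: comp_functor_def id_functor_def G_def)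
  qed
  moreover have "naturally_isomorphic A A (comp_functor G F) id_functor"
    unfolding naturally_isomorphic_def natural_transformation_def isomorphism_def
  \<comment> \<open>The component at \<open>a\<close> is the preimage under \<open>F\<close> of
    \<open>e\<close> at \<open>F a\<close>; its inverse \<open>?e'\<close> is the preimage of
    \<open>e'\<close> there.\<close>
  proof (intro exI[of _ "\<lambda>a. pre (g (on_ob F a)) a (e (on_ob F a))"] conjI ballI)
    fix a b f assume ob: "a \<in> ob A" "b \<in> ob A" and f: "f \<in> hom A a b"
    have Fob: "on_ob F a \<in> ob B" "on_ob F b \<in> ob B" using ob functor_ob[OF F] by auto
    note Ff = functor_hom[OF F ob f]
    show "cmp A (on_ob (comp_functor G F) a) (on_ob (comp_functor G F) b) (on_ob id_functor b)
          (pre (g (on_ob F b)) b (e (on_ob F b))) (on_hom (comp_functor G F) a b f) =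
        cmp A (on_ob (comp_functor G F) a) (on_ob id_functor a) (on_ob id_functor b)
          (on_hom id_functor a b f) (pre (g (on_ob F a)) a (e (on_ob F a)))"
      unfolding comp_functor_def id_functor_def G_def
      using ob f Fob Ff g pre e k
      by (intro faithful[of "g (on_ob F a)" b])
        (simp_all add: comp_in_hom[OF A] functor_comp[OF F] ek)
  next
    fix a assume a: "a \<in> ob A"
    have Fa: "on_ob F a \<in> ob B" using a functor_ob[OF F] by auto
    show in_hom: "pre (g (on_ob F a)) a (e (on_ob F a))
        \<in> hom A (on_ob (comp_functor G F) a) (on_ob id_functor a)"
      using a Fa e g pre by (simp add: comp_functor_def id_functor_def G_def)
    then show "pre (g (on_ob F a)) a (e (on_ob F a))
        \<in> hom A (on_ob (comp_functor G F) a) (on_ob id_functor a)" .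
    let ?e = "pre (g (on_ob F a)) a (e (on_ob F a))" and ?e' = "pre a (g (on_ob F a)) (e' (on_ob F a))"
    have "cmp A (g (on_ob F a)) a (g (on_ob F a)) ?e' ?e = idn A (g (on_ob F a))"
      using a Fa g pre e e' e'e
      by (intro faithful[of "g (on_ob F a)" "g (on_ob F a)"])
        (simp_all add: comp_in_hom[OF A] id_in_hom[OF A] functor_comp[OF F] functor_id[OF F])
    moreover have "cmp A a (g (on_ob F a)) a ?e ?e' = idn A a"
      using a Fa g pre e e' ee'
      by (intro faithful[of a a])
        (simp_all add: comp_in_hom[OF A] id_in_hom[OF A] functor_comp[OF F] functor_id[OF F])
    ultimately show "\<exists>f\<in>hom A (on_ob id_functor a) (on_ob (comp_functor G F) a).
        cmp A (on_ob (comp_functor G F) a) (on_ob id_functor a) (on_ob (comp_functor G F) a) f ?e =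
          idn A (on_ob (comp_functor G F) a) \<and>
        cmp A (on_ob id_functor a) (on_ob (comp_functor G F) a) (on_ob id_functor a) ?e f =
          idn A (on_ob id_functor a)"
      using a Fa g pre e'
      by (intro bexI[of _ ?e']) (simp_all add: comp_functor_def id_functor_def G_def)
  qed
  ultimately show ?thesis using F G unfolding equivalence_def by blast
qed

lemma equivalence_iff:
  assumes "category A" "category B" "is_functor A B F"
  shows "equivalence A B F \<longleftrightarrow> fully_faithful A B F \<and> essentially_surjective A B F"
  using assms equivalence_fully_faithful equivalence_essentially_surjective equivalence_intro by metis

section \<open>The categories and functors of the square\<close>

lemma categoryI:
  assumes "\<And>a. a \<in> ob C \<Longrightarrow> idn C a \<in> hom C a a"
    and "\<And>a b c f g. a \<in> ob C \<Longrightarrow> b \<in> ob C \<Longrightarrow> c \<in> ob C \<Longrightarrow> f \<in> hom C a b \<Longrightarrow> g \<in> hom C b c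
      \<Longrightarrow> cmp C a b c g f \<in> hom C a c"
    and "\<And>a b f. a \<in> ob C \<Longrightarrow> b \<in> ob C \<Longrightarrow> f \<in> hom C a b \<Longrightarrow> cmp C a a b f (idn C a) = f"
    and "\<And>a b f. a \<in> ob C \<Longrightarrow> b \<in> ob C \<Longrightarrow> f \<in> hom C a b \<Longrightarrow> cmp C a b b (idn C b) f = f"
    and "\<And>a b c d f g h. a \<in> ob C \<Longrightarrow> b \<in> ob C \<Longrightarrow> c \<in> ob C \<Longrightarrow> d \<in> ob C
      \<Longrightarrow> f \<in> hom C a b \<Longrightarrow> g \<in> hom C b c \<Longrightarrow> h \<in> hom C c d
      \<Longrightarrow> cmp C a c d h (cmp C a b c g f) = cmp C a b d (cmp C b c d h g) f"
  shows "category C"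
  unfolding category_def using assms by simp

lemma functorI:
  assumes "\<And>a. a \<in> ob A \<Longrightarrow> on_ob F a \<in> ob B"
    and "\<And>a b f. a \<in> ob A \<Longrightarrow> b \<in> ob A \<Longrightarrow> f \<in> hom A a b
      \<Longrightarrow> on_hom F a b f \<in> hom B (on_ob F a) (on_ob F b)"
    and "\<And>a. a \<in> ob A \<Longrightarrow> on_hom F a a (idn A a) = idn B (on_ob F a)"
    and "\<And>a b c f g. a \<in> ob A \<Longrightarrow> b \<in> ob A \<Longrightarrow> c \<in> ob A \<Longrightarrow> f \<in> hom A a b \<Longrightarrow> g \<in> hom A b c
      \<Longrightarrow> on_hom F a c (cmp A a b c g f) =
        cmp B (on_ob F a) (on_ob F b) (on_ob F c) (on_hom F b c g) (on_hom F a b f)"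
  shows "is_functor A B F"
  unfolding is_functor_def using assms by simp

lemma category_slice:
  assumes C: "category C" and x: "x \<in> ob C"
  shows "category (slice C x)"
  by (rule categoryI)
    (use x in \<open>auto simp: slice_def id_in_hom[OF C] comp_in_hom[OF C] comp_id_left[OF C]
        comp_id_right[OF C] comp_assoc[OF C]\<close>)

lemma category_prod_cat:
  assumes A: "\<And>i. i \<in> I \<Longrightarrow> category (A i)"
  shows "category (prod_cat I A)"
proof (rule categoryI)
  fix a assume "a \<in> ob (prod_cat I A)"
  then show "idn (prod_cat I A) a \<in> hom (prod_cat I A) a a"
    by (auto simp: prod_cat_def PiE_iff id_in_hom[OF A])
next
  fix a b f assume *: "a \<in> ob (prod_cat I A)" "b \<in> ob (prod_cat I A)" "f \<in> hom (prod_cat I A) a b"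
  then show "cmp (prod_cat I A) a a b f (idn (prod_cat I A) a) = f"
    by (auto simp: prod_cat_def PiE_iff comp_id_right[OF A] extensional_def fun_eq_iff)
  from * show "cmp (prod_cat I A) a b b (idn (prod_cat I A) b) f = f"
    by (auto simp: prod_cat_def PiE_iff comp_id_left[OF A] extensional_def fun_eq_iff)
next
  fix a b c f g
  assume "a \<in> ob (prod_cat I A)" "b \<in> ob (prod_cat I A)" "c \<in> ob (prod_cat I A)"
    "f \<in> hom (prod_cat I A) a b" "g \<in> hom (prod_cat I A) b c"
  then show "cmp (prod_cat I A) a b c g f \<in> hom (prod_cat I A) a c"
    by (auto simp: prod_cat_def PiE_iff intro!: comp_in_hom[OF A])
next
  fix a b c d f g h
  assume "a \<in> ob (prod_cat I A)" "b \<in> ob (prod_cat I A)" "c \<in> ob (prod_cat I A)"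
    "d \<in> ob (prod_cat I A)" "f \<in> hom (prod_cat I A) a b" "g \<in> hom (prod_cat I A) b c"
    "h \<in> hom (prod_cat I A) c d"
  then show "cmp (prod_cat I A) a c d h (cmp (prod_cat I A) a b c g f) =
      cmp (prod_cat I A) a b d (cmp (prod_cat I A) b c d h g) f"
    by (auto simp: prod_cat_def PiE_iff intro!: restrict_ext comp_assoc[OF A])
qed

lemma category_set_cat: "category (set_cat U)"
  by (rule categoryI)
    (auto simp: set_cat_def compose_def PiE_iff extensional_def fun_eq_iff)

lemma category_Fam:
  assumes C: "category C"
  shows "category (Fam C U)"
proof (rule categoryI)
  fix a assume "a \<in> ob (Fam C U)"
  then show "idn (Fam C U) a \<in> hom (Fam C U) a a"
    by (auto simp: Fam_def PiE_iff id_in_hom[OF C])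
next
  fix a b f assume "a \<in> ob (Fam C U)" "b \<in> ob (Fam C U)" "f \<in> hom (Fam C U) a b"
  then obtain X c Y d g \<phi> where eqs: "a = (X, c)" "b = (Y, d)" "f = (g, \<phi>)"
    and c: "\<And>x. x \<in> X \<Longrightarrow> c x \<in> ob C" and d: "\<And>y. y \<in> Y \<Longrightarrow> d y \<in> ob C"
    and g: "g \<in> extensional X" "\<And>x. x \<in> X \<Longrightarrow> g x \<in> Y"
    and \<phi>: "\<phi> \<in> extensional X" "\<And>x. x \<in> X \<Longrightarrow> \<phi> x \<in> hom C (c x) (d (g x))"
    by (auto simp: Fam_def PiE_iff)
  show "cmp (Fam C U) a a b f (idn (Fam C U) a) = f"
    using g \<phi> by (auto simp: eqs Fam_def compose_def comp_id_right[OF C] c d extensional_def fun_eq_iff)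
  show "cmp (Fam C U) a b b (idn (Fam C U) b) f = f"
    using g \<phi> by (auto simp: eqs Fam_def compose_def comp_id_left[OF C] c d extensional_def fun_eq_iff)
next
  fix a b c f g
  assume "a \<in> ob (Fam C U)" "b \<in> ob (Fam C U)" "c \<in> ob (Fam C U)"
    "f \<in> hom (Fam C U) a b" "g \<in> hom (Fam C U) b c"
  then show "cmp (Fam C U) a b c g f \<in> hom (Fam C U) a c"
    by (auto simp: Fam_def PiE_iff compose_def intro!: comp_in_hom[OF C])
next
  fix a b c d f g h
  assume "a \<in> ob (Fam C U)" "b \<in> ob (Fam C U)" "c \<in> ob (Fam C U)" "d \<in> ob (Fam C U)"
    "f \<in> hom (Fam C U) a b" "g \<in> hom (Fam C U) b c" "h \<in> hom (Fam C U) c d"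
  then show "cmp (Fam C U) a c d h (cmp (Fam C U) a b c g f) =
      cmp (Fam C U) a b d (cmp (Fam C U) b c d h g) f"
    by (auto simp: Fam_def PiE_iff compose_def intro!: restrict_ext comp_assoc[OF C])
qed

text \<open>Composites stay in the comma category because the squares of \<open>f\<close> and
  \<open>g\<close> paste, \<open>F\<close> and \<open>G\<close> preserving composition; units and
  associativity hold componentwise in \<open>A\<close> and \<open>B\<close>.\<close>

lemma category_comma:
  assumes A: "category A" and B: "category B" and C: "category C"
    and F: "is_functor A C F" and G: "is_functor B C G"
  shows "category (comma A B C F G)"
proof (rule categoryI)
  note [simp] = functor_ob[OF F] functor_ob[OF G] functor_hom[OF F] functor_hom[OF G]
    functor_id[OF F] functor_id[OF G] functor_comp[OF F] functor_comp[OF G]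
  fix x y z :: "'a \<times> 'c \<times> 'f" and f g :: "'b \<times> 'd"
  obtain a b h a' b' h' a'' b'' h'' f1 f2 g1 g2 where
    eqs: "x = (a, b, h)" "y = (a', b', h')" "z = (a'', b'', h'')" "f = (f1, f2)" "g = (g1, g2)"
    by (metis prod.exhaust)
  assume "x \<in> ob (comma A B C F G)" "y \<in> ob (comma A B C F G)" "z \<in> ob (comma A B C F G)"
    "f \<in> hom (comma A B C F G) x y" "g \<in> hom (comma A B C F G) y z"
  then have ob: "a \<in> ob A" "b \<in> ob B" "a' \<in> ob A" "b' \<in> ob B" "a'' \<in> ob A" "b'' \<in> ob B"
    and h: "h \<in> hom C (on_ob F a) (on_ob G b)" "h' \<in> hom C (on_ob F a') (on_ob G b')"
      "h'' \<in> hom C (on_ob F a'') (on_ob G b'')"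
    and f: "f1 \<in> hom A a a'" "f2 \<in> hom B b b'"
    and g: "g1 \<in> hom A a' a''" "g2 \<in> hom B b' b''"
    and sq1: "cmp C (on_ob F a) (on_ob F a') (on_ob G b') h' (on_hom F a a' f1) =
          cmp C (on_ob F a) (on_ob G b) (on_ob G b') (on_hom G b b' f2) h"
    and sq2: "cmp C (on_ob F a') (on_ob F a'') (on_ob G b'') h'' (on_hom F a' a'' g1) =
          cmp C (on_ob F a') (on_ob G b') (on_ob G b'') (on_hom G b' b'' g2) h'"
    by (auto simp: comma_def eqs)
  have "cmp C (on_ob F a) (on_ob F a'') (on_ob G b'') h''
        (cmp C (on_ob F a) (on_ob F a') (on_ob F a'') (on_hom F a' a'' g1) (on_hom F a a' f1))
      = cmp C (on_ob F a) (on_ob F a') (on_ob G b'')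
        (cmp C (on_ob F a') (on_ob G b') (on_ob G b'') (on_hom G b' b'' g2) h') (on_hom F a a' f1)"
    using ob h f g by (simp add: comp_assoc[OF C] sq2)
  also have "\<dots> = cmp C (on_ob F a) (on_ob G b') (on_ob G b'') (on_hom G b' b'' g2)
        (cmp C (on_ob F a) (on_ob G b) (on_ob G b') (on_hom G b b' f2) h)"
    using ob h f g by (simp add: comp_assoc[OF C, symmetric] sq1)
  also have "\<dots> = cmp C (on_ob F a) (on_ob G b) (on_ob G b'')
        (cmp C (on_ob G b) (on_ob G b') (on_ob G b'') (on_hom G b' b'' g2) (on_hom G b b' f2)) h"
    using ob h f g by (simp add: comp_assoc[OF C])
  finally show "cmp (comma A B C F G) x y z g f \<in> hom (comma A B C F G) x z"
    using ob h f g by (simp add: comma_def eqs comp_in_hom[OF A] comp_in_hom[OF B])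
next
  fix x assume "x \<in> ob (comma A B C F G)"
  then show "idn (comma A B C F G) x \<in> hom (comma A B C F G) x x"
    by (auto simp: comma_def id_in_hom[OF A] id_in_hom[OF B] functor_id[OF F] functor_id[OF G]
        comp_id_left[OF C] comp_id_right[OF C] functor_ob[OF F] functor_ob[OF G])
qed (auto simp: comma_def comp_id_left[OF A] comp_id_left[OF B] comp_id_right[OF A]
      comp_id_right[OF B] comp_assoc[OF A] comp_assoc[OF B])

lemma id_functor_is_functor: "is_functor C C id_functor"
  by (rule functorI) (simp_all add: id_functor_def)

lemma index_functor_is_functor: "is_functor (Fam C U) (set_cat U) index_functor"
  by (rule functorI) (auto simp: index_functor_def Fam_def set_cat_def)

text \<open>Naturality of \<open>\<sigma>\<close> at \<open>k\<close> is precisely the condition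
  that the pair of images of \<open>k\<close> under \<open>P\<close> and \<open>Q\<close> be a
  morphism of the comma category.\<close>

lemma comma_functor_is_functor:
  assumes "lax_square E A B C P Q F G \<sigma>"
  shows "is_functor E (comma A B C F G) (comma_functor P Q \<sigma>)"
proof -
  have P: "is_functor E A P" and Q: "is_functor E B Q"
    and \<sigma>: "natural_transformation E C (comp_functor F P) (comp_functor G Q) \<sigma>"
    using assms unfolding lax_square_def by auto
  show ?thesis
    by (rule functorI)
      (use \<sigma> in \<open>auto simp: comma_def comma_functor_def natural_transformation_def comp_functor_def
        functor_ob[OF P] functor_ob[OF Q] functor_hom[OF P] functor_hom[OF Q]
        functor_id[OF P] functor_id[OF Q] functor_comp[OF P] functor_comp[OF Q]\<close>)
qed

section \<open>Calculus of chosen coproducts, copowers of the terminal object, and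
  \<open>sigma\<close>\<close>

locale coproduct_category =
  fixes C :: "('o, 'm) cat"
    and U :: "'i set set"
    and K :: "('i, 'o, 'm) coproduct_choice"
    and one :: 'o
  assumes universe: "small_universe U"
    and category: "category C"
    and coproducts: "has_coproducts C U K"
    and terminal: "terminal C one"
begin

abbreviation points :: "'i set \<Rightarrow> 'i \<Rightarrow> 'o" where "points X \<equiv> (\<lambda>x\<in>X. one)"
abbreviation copow :: "'i set \<Rightarrow> 'o" where "copow X \<equiv> csum K X (points X)"
abbreviation bang :: "'o \<Rightarrow> 'm" where "bang \<equiv> to_terminal C one"

lemmas id_in = id_in_hom[OF category]
  and comp_in = comp_in_hom[OF category]
  and id_left = comp_id_left[OF category]
  and id_right = comp_id_right[OF category]
  and assoc = comp_assoc[OF category]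

lemma one_ob [simp]: "one \<in> ob C"
  using terminal unfolding terminal_def by blast

lemma bang_in [simp]: "c \<in> ob C \<Longrightarrow> bang c \<in> hom C c one"
  unfolding to_terminal_def by (rule theI') (use terminal in \<open>auto simp: terminal_def\<close>)

lemma bang_unique: "c \<in> ob C \<Longrightarrow> f \<in> hom C c one \<Longrightarrow> f = bang c"
  using terminal bang_in unfolding terminal_def by blast

lemma points_in [simp]: "points X \<in> X \<rightarrow>\<^sub>E ob C"
  by simp

lemma is_coproduct: "X \<in> U \<Longrightarrow> c \<in> X \<rightarrow>\<^sub>E ob C \<Longrightarrow> is_coproduct C X c (csum K X c) (incl K X c)"
  using coproducts unfolding has_coproducts_def by blast

lemma csum_ob [simp]: "X \<in> U \<Longrightarrow> c \<in> X \<rightarrow>\<^sub>E ob C \<Longrightarrow> csum K X c \<in> ob C"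
  using is_coproduct unfolding is_coproduct_def by blast

lemma incl_in [simp]: "X \<in> U \<Longrightarrow> c \<in> X \<rightarrow>\<^sub>E ob C \<Longrightarrow> x \<in> X \<Longrightarrow> incl K X c x \<in> hom C (c x) (csum K X c)"
  using is_coproduct unfolding is_coproduct_def by blast

lemma incl_points_in [simp]: "X \<in> U \<Longrightarrow> x \<in> X \<Longrightarrow> incl K X (points X) x \<in> hom C one (copow X)"
  using incl_in[of X "points X" x] by simp

context
  fixes X c z \<phi>
  assumes X: "X \<in> U" and c: "c \<in> X \<rightarrow>\<^sub>E ob C" and z: "z \<in> ob C"
    and \<phi>: "\<And>x. x \<in> X \<Longrightarrow> \<phi> x \<in> hom C (c x) z"
begin

lemma cotuple_unique_exists:
  "\<exists>!u. u \<in> hom C (csum K X c) z \<and> (\<forall>x\<in>X. cmp C (c x) (csum K X c) z u (incl K X c x) = \<phi> x)"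
  using is_coproduct[OF X c] z \<phi> unfolding is_coproduct_def by blast

lemma cotuple_in: "cotuple C K X c z \<phi> \<in> hom C (csum K X c) z"
  unfolding cotuple_def using theI'[OF cotuple_unique_exists] by blast

lemma cotuple_incl: "x \<in> X \<Longrightarrow> cmp C (c x) (csum K X c) z (cotuple C K X c z \<phi>) (incl K X c x) = \<phi> x"
  unfolding cotuple_def using theI'[OF cotuple_unique_exists] by blast

end

text \<open>Both \<open>u\<close> and \<open>v\<close> solve the universal problem posed by the
  restrictions of \<open>u\<close>. Equations between morphisms out of a coproduct are reduced to
  the summands this way.\<close>

lemma csum_ext:
  assumes "X \<in> U" "c \<in> X \<rightarrow>\<^sub>E ob C" "z \<in> ob C" "u \<in> hom C (csum K X c) z" "v \<in> hom C (csum K X c) z"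
    and "\<And>x. x \<in> X \<Longrightarrow> cmp C (c x) (csum K X c) z u (incl K X c x)
      = cmp C (c x) (csum K X c) z v (incl K X c x)"
  shows "u = v"
proof -
  have "\<exists>!w. w \<in> hom C (csum K X c) z \<and>
      (\<forall>x\<in>X. cmp C (c x) (csum K X c) z w (incl K X c x) = cmp C (c x) (csum K X c) z u (incl K X c x))"
    using assms by (intro cotuple_unique_exists comp_in) (auto simp: PiE_iff)
  with assms show ?thesis by metis
qed

lemma
  assumes "X \<in> U" "c \<in> X \<rightarrow>\<^sub>E ob C" "Y \<in> U" "d \<in> Y \<rightarrow>\<^sub>E ob C"
    and "\<And>x. x \<in> X \<Longrightarrow> f x \<in> Y" and "\<And>x. x \<in> X \<Longrightarrow> \<phi> x \<in> hom C (c x) (d (f x))"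
  shows sum_functor_in: "on_hom (sum_functor C K) (X, c) (Y, d) (f, \<phi>) \<in> hom C (csum K X c) (csum K Y d)"
    and sum_functor_incl: "x \<in> X \<Longrightarrow>
      cmp C (c x) (csum K X c) (csum K Y d) (on_hom (sum_functor C K) (X, c) (Y, d) (f, \<phi>)) (incl K X c x)
      = cmp C (c x) (d (f x)) (csum K Y d) (incl K Y d (f x)) (\<phi> x)"
proof -
  have *: "cmp C (c x) (d (f x)) (csum K Y d) (incl K Y d (f x)) (\<phi> x) \<in> hom C (c x) (csum K Y d)"
    if "x \<in> X" for x
    using assms that by (intro comp_in) auto
  show "on_hom (sum_functor C K) (X, c) (Y, d) (f, \<phi>) \<in> hom C (csum K X c) (csum K Y d)"
    using assms * by (simp add: sum_functor_def cotuple_in)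
  show "cmp C (c x) (csum K X c) (csum K Y d) (on_hom (sum_functor C K) (X, c) (Y, d) (f, \<phi>)) (incl K X c x)
      = cmp C (c x) (d (f x)) (csum K Y d) (incl K Y d (f x)) (\<phi> x)" if "x \<in> X"
    using assms * that by (simp add: sum_functor_def cotuple_incl)
qed

lemma
  assumes "X \<in> U" "c \<in> X \<rightarrow>\<^sub>E ob C" "d \<in> X \<rightarrow>\<^sub>E ob C" and "\<And>x. x \<in> X \<Longrightarrow> \<phi> x \<in> hom C (c x) (d x)"
  shows sum_hom_in: "sum_hom C K X c d \<phi> \<in> hom C (csum K X c) (csum K X d)"
    and sum_hom_incl: "x \<in> X \<Longrightarrow>
      cmp C (c x) (csum K X c) (csum K X d) (sum_hom C K X c d \<phi>) (incl K X c x)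
      = cmp C (c x) (d x) (csum K X d) (incl K X d x) (\<phi> x)"
  using sum_functor_in[of X c X d "\<lambda>x\<in>X. x" \<phi>] sum_functor_incl[of X c X d "\<lambda>x\<in>X. x" \<phi> x] assms
  by (auto simp: sum_hom_def)

lemma
  assumes "X \<in> U" "c \<in> X \<rightarrow>\<^sub>E ob C"
  shows sigma_in [simp]: "sigma C K one (X, c) \<in> hom C (csum K X c) (copow X)"
    and sigma_incl: "x \<in> X \<Longrightarrow>
      cmp C (c x) (csum K X c) (copow X) (sigma C K one (X, c)) (incl K X c x)
      = cmp C (c x) one (copow X) (incl K X (points X) x) (bang (c x))"
  using sum_hom_in[of X c "points X" "\<lambda>x\<in>X. bang (c x)"]
    sum_hom_incl[of X c "points X" "\<lambda>x\<in>X. bang (c x)" x] assms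
  by (auto simp: sigma_def PiE_iff)

lemma
  assumes "X \<in> U" "Y \<in> U" "\<And>x. x \<in> X \<Longrightarrow> f x \<in> Y"
  shows copower_in: "on_hom (copower_functor C K one) X Y f \<in> hom C (copow X) (copow Y)"
    and copower_incl: "x \<in> X \<Longrightarrow>
      cmp C one (copow X) (copow Y) (on_hom (copower_functor C K one) X Y f) (incl K X (points X) x)
      = incl K Y (points Y) (f x)"
proof -
  have *: "incl K Y (points Y) (f x) \<in> hom C (points X x) (copow Y)" if "x \<in> X" for x
    using assms that by auto
  show "on_hom (copower_functor C K one) X Y f \<in> hom C (copow X) (copow Y)"
    using assms * by (simp add: copower_functor_def cotuple_in)
  show "cmp C one (copow X) (copow Y) (on_hom (copower_functor C K one) X Y f) (incl K X (points X) x)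
      = incl K Y (points Y) (f x)" if "x \<in> X"
    using assms * that cotuple_incl[of X "points X" "copow Y" "\<lambda>x. incl K Y (points Y) (f x)" x]
    by (simp add: copower_functor_def)
qed

text \<open>On the summand \<open>x\<close> the composite collapses \<open>c x\<close> to the
  terminal object and continues with the coprojection at \<open>f x\<close>. This is the right-hand
  side of the cone condition at \<open>y = f x\<close>, so compatibility with \<open>f\<close>
  becomes a condition on single indices.\<close>

lemma copower_sigma_incl:
  assumes "X \<in> U" "c \<in> X \<rightarrow>\<^sub>E ob C" "Y \<in> U" "\<And>x. x \<in> X \<Longrightarrow> f x \<in> Y" "x \<in> X"
  shows "cmp C (c x) (csum K X c) (copow Y) (cmp C (csum K X c) (copow X) (copow Y)
        (on_hom (copower_functor C K one) X Y f) (sigma C K one (X, c))) (incl K X c x)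
      = cmp C (c x) one (copow Y) (incl K Y (points Y) (f x)) (bang (c x))"
proof -
  have [simp]: "c x \<in> ob C" using assms by auto
  have "cmp C (c x) (csum K X c) (copow Y) (cmp C (csum K X c) (copow X) (copow Y)
        (on_hom (copower_functor C K one) X Y f) (sigma C K one (X, c))) (incl K X c x)
      = cmp C (c x) (copow X) (copow Y) (on_hom (copower_functor C K one) X Y f)
        (cmp C (c x) one (copow X) (incl K X (points X) x) (bang (c x)))"
    using assms copower_in by (simp add: assoc[symmetric] sigma_incl)
  also have "\<dots> = cmp C (c x) one (copow Y) (cmp C one (copow X) (copow Y)
      (on_hom (copower_functor C K one) X Y f) (incl K X (points X) x)) (bang (c x))"
    using assms copower_in by (simp add: assoc)
  finally show ?thesis using assms by (simp add: copower_incl)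
qed

text \<open>Both functor laws are compared on the coprojections, where
  \<open>sum_functor_incl\<close> computes each side.\<close>

lemma sum_functor_is_functor: "is_functor (Fam C U) C (sum_functor C K)"
proof (rule functorI)
  fix a assume "a \<in> ob (Fam C U)"
  then show "on_ob (sum_functor C K) a \<in> ob C"
    by (auto simp: Fam_def sum_functor_def)
next
  fix a b f assume "a \<in> ob (Fam C U)" "b \<in> ob (Fam C U)" "f \<in> hom (Fam C U) a b"
  then obtain X c Y d g \<phi> where eqs: "a = (X, c)" "b = (Y, d)" "f = (g, \<phi>)"
    and "X \<in> U" "c \<in> X \<rightarrow>\<^sub>E ob C" "Y \<in> U" "d \<in> Y \<rightarrow>\<^sub>E ob C"
      "g \<in> X \<rightarrow>\<^sub>E Y" "\<phi> \<in> (\<Pi>\<^sub>E x\<in>X. hom C (c x) (d (g x)))"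
    by (auto simp: Fam_def)
  then show "on_hom (sum_functor C K) a b f \<in> hom C (on_ob (sum_functor C K) a) (on_ob (sum_functor C K) b)"
    using sum_functor_in[of X c Y d g \<phi>] by (auto simp: sum_functor_def)
next
  fix a assume "a \<in> ob (Fam C U)"
  then obtain X c where a: "a = (X, c)" and X: "X \<in> U" and c: "c \<in> X \<rightarrow>\<^sub>E ob C"
    by (auto simp: Fam_def)
  let ?i = "\<lambda>x\<in>X. x" and ?id = "\<lambda>x\<in>X. idn C (c x)"
  have idc: "?id x \<in> hom C (c x) (c (?i x))" if "x \<in> X" for x
    using c that by (auto intro: id_in)
  have "on_hom (sum_functor C K) (X, c) (X, c) (?i, ?id) = idn C (csum K X c)"
  proof (rule csum_ext[OF X c])
    fix x assume x: "x \<in> X"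
    then have "c x \<in> ob C" using c by auto
    then show "cmp C (c x) (csum K X c) (csum K X c)
          (on_hom (sum_functor C K) (X, c) (X, c) (?i, ?id)) (incl K X c x)
        = cmp C (c x) (csum K X c) (csum K X c) (idn C (csum K X c)) (incl K X c x)"
      using sum_functor_incl[of X c X c ?i ?id x] X c x idc by (simp add: id_left id_right)
  qed (use X c idc in \<open>auto intro!: sum_functor_in id_in\<close>)
  then show "on_hom (sum_functor C K) a a (idn (Fam C U) a) = idn C (on_ob (sum_functor C K) a)"
    by (simp add: a Fam_def sum_functor_def)
next
  fix a b b' f g
  assume "a \<in> ob (Fam C U)" "b \<in> ob (Fam C U)" "b' \<in> ob (Fam C U)"
    "f \<in> hom (Fam C U) a b" "g \<in> hom (Fam C U) b b'"
  then obtain X c Y d Z e h \<phi> k \<psi> where eqs: "a = (X, c)" "b = (Y, d)" "b' = (Z, e)" "f = (h, \<phi>)" "g = (k, \<psi>)"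
    and X: "X \<in> U" "c \<in> X \<rightarrow>\<^sub>E ob C" and Y: "Y \<in> U" "d \<in> Y \<rightarrow>\<^sub>E ob C" and Z: "Z \<in> U" "e \<in> Z \<rightarrow>\<^sub>E ob C"
    and h: "h \<in> X \<rightarrow>\<^sub>E Y" "\<phi> \<in> (\<Pi>\<^sub>E x\<in>X. hom C (c x) (d (h x)))"
    and k: "k \<in> Y \<rightarrow>\<^sub>E Z" "\<psi> \<in> (\<Pi>\<^sub>E y\<in>Y. hom C (d y) (e (k y)))"
    by (auto simp: Fam_def)
  let ?\<chi> = "\<lambda>x\<in>X. cmp C (c x) (d (h x)) (e (k (h x))) (\<psi> (h x)) (\<phi> x)"
  have hx: "h x \<in> Y" "k (h x) \<in> Z" "c x \<in> ob C" "d (h x) \<in> ob C" "e (k (h x)) \<in> ob C"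
    "\<phi> x \<in> hom C (c x) (d (h x))" "\<psi> (h x) \<in> hom C (d (h x)) (e (k (h x)))" if "x \<in> X" for x
    using X Y Z h k that by (auto simp: PiE_iff)
  have \<chi>: "?\<chi> x \<in> hom C (c x) (e (compose X k h x))" if "x \<in> X" for x
    using hx[OF that] that by (simp add: compose_def comp_in)
  note f_in = sum_functor_in[OF X Y, of h \<phi>] and f_incl = sum_functor_incl[OF X Y, of h \<phi>]
  note g_in = sum_functor_in[OF Y Z, of k \<psi>] and g_incl = sum_functor_incl[OF Y Z, of k \<psi>]
  have f_in: "on_hom (sum_functor C K) (X, c) (Y, d) (h, \<phi>) \<in> hom C (csum K X c) (csum K Y d)"
    using f_in h by auto
  have g_in: "on_hom (sum_functor C K) (Y, d) (Z, e) (k, \<psi>) \<in> hom C (csum K Y d) (csum K Z e)"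
    using g_in k by auto
  have "on_hom (sum_functor C K) (X, c) (Z, e) (compose X k h, ?\<chi>)
    = cmp C (csum K X c) (csum K Y d) (csum K Z e)
        (on_hom (sum_functor C K) (Y, d) (Z, e) (k, \<psi>)) (on_hom (sum_functor C K) (X, c) (Y, d) (h, \<phi>))"
    (is "?l = ?r")
  proof (rule csum_ext[OF X])
    show "?l \<in> hom C (csum K X c) (csum K Z e)"
      by (rule sum_functor_in[OF X Z]) (use hx \<chi> in \<open>auto simp: compose_def\<close>)
    fix x assume x: "x \<in> X"
    note [simp] = hx[OF x]
    have "cmp C (c x) (csum K X c) (csum K Z e) ?r (incl K X c x)
      = cmp C (c x) (csum K Y d) (csum K Z e) (on_hom (sum_functor C K) (Y, d) (Z, e) (k, \<psi>))
          (cmp C (c x) (d (h x)) (csum K Y d) (incl K Y d (h x)) (\<phi> x))"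
      using X Y Z f_in g_in x f_incl[OF _ _ x] hx by (simp add: assoc[symmetric])
    also have "\<dots> = cmp C (c x) (d (h x)) (csum K Z e)
          (cmp C (d (h x)) (e (k (h x))) (csum K Z e) (incl K Z e (k (h x))) (\<psi> (h x))) (\<phi> x)"
      using X Y Z g_in g_incl[of "h x"] k by (simp add: assoc PiE_iff)
    also have "\<dots> = cmp C (c x) (e (k (h x))) (csum K Z e) (incl K Z e (k (h x))) (?\<chi> x)"
      using X Z x by (simp add: assoc)
    also have "\<dots> = cmp C (c x) (csum K X c) (csum K Z e) ?l (incl K X c x)"
      using sum_functor_incl[OF X Z, of "compose X k h" ?\<chi> x] x \<chi> hx by (simp add: compose_def)
    finally show "cmp C (c x) (csum K X c) (csum K Z e) ?l (incl K X c x)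
      = cmp C (c x) (csum K X c) (csum K Z e) ?r (incl K X c x)" by simp
  qed (use X Y Z f_in g_in in \<open>auto intro: comp_in\<close>)
  then show "on_hom (sum_functor C K) a b' (cmp (Fam C U) a b b' g f) =
      cmp C (on_ob (sum_functor C K) a) (on_ob (sum_functor C K) b) (on_ob (sum_functor C K) b')
        (on_hom (sum_functor C K) b b' g) (on_hom (sum_functor C K) a b f)"
    by (simp add: eqs Fam_def sum_functor_def)
qed

lemma copower_is_functor: "is_functor (set_cat U) C (copower_functor C K one)"
proof (rule functorI)
  fix X assume "X \<in> ob (set_cat U)"
  then show "on_ob (copower_functor C K one) X \<in> ob C"
    by (simp add: set_cat_def copower_functor_def)
next
  fix X Y f assume "X \<in> ob (set_cat U)" "Y \<in> ob (set_cat U)" "f \<in> hom (set_cat U) X Y"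
  then show "on_hom (copower_functor C K one) X Y f
      \<in> hom C (on_ob (copower_functor C K one) X) (on_ob (copower_functor C K one) Y)"
    using copower_in[of X Y f] by (auto simp: set_cat_def copower_functor_def)
next
  fix X assume "X \<in> ob (set_cat U)"
  then have X: "X \<in> U" by (simp add: set_cat_def)
  have "on_hom (copower_functor C K one) X X (\<lambda>x\<in>X. x) = idn C (copow X)"
    by (rule csum_ext[OF X])
      (use X copower_in[of X X "\<lambda>x\<in>X. x"] copower_incl[of X X "\<lambda>x\<in>X. x"]
        in \<open>auto simp: id_in id_left\<close>)
  then show "on_hom (copower_functor C K one) X X (idn (set_cat U) X)
      = idn C (on_ob (copower_functor C K one) X)"
    by (simp add: set_cat_def copower_functor_def)
next
  fix X Y Z f g
  assume "X \<in> ob (set_cat U)" "Y \<in> ob (set_cat U)" "Z \<in> ob (set_cat U)"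
    "f \<in> hom (set_cat U) X Y" "g \<in> hom (set_cat U) Y Z"
  then have U: "X \<in> U" "Y \<in> U" "Z \<in> U" and fg: "\<And>x. x \<in> X \<Longrightarrow> f x \<in> Y" "\<And>y. y \<in> Y \<Longrightarrow> g y \<in> Z"
    by (auto simp: set_cat_def)
  let ?T = "on_hom (copower_functor C K one)"
  have "?T X Z (compose X g f) = cmp C (copow X) (copow Y) (copow Z) (?T Y Z g) (?T X Y f)"
    by (rule csum_ext[OF U(1)])
      (use U fg copower_in[of X Z "compose X g f"] copower_in[of X Y f] copower_in[of Y Z g]
        copower_incl[of X Z "compose X g f"] copower_incl[of X Y f] copower_incl[of Y Z g]
        in \<open>auto simp: comp_in compose_def assoc[symmetric]\<close>)
  then show "?T X Z (cmp (set_cat U) X Y Z g f) =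
      cmp C (on_ob (copower_functor C K one) X) (on_ob (copower_functor C K one) Y)
        (on_ob (copower_functor C K one) Z) (?T Y Z g) (?T X Y f)"
    by (simp add: set_cat_def copower_functor_def)
qed

text \<open>Tested on the summand \<open>x\<close>, both sides pass through
  \<open>c x \<rightarrow> 1\<close>, because
  \<open>c x \<rightarrow> d (f x) \<rightarrow> 1\<close> is the unique morphism to the terminal
  object.\<close>

lemma sigma_natural:
  assumes X: "X \<in> U" "c \<in> X \<rightarrow>\<^sub>E ob C" and Y: "Y \<in> U" "d \<in> Y \<rightarrow>\<^sub>E ob C"
    and f: "\<And>x. x \<in> X \<Longrightarrow> f x \<in> Y" and u: "u \<in> hom C (csum K X c) (csum K Y d)"
    and \<phi>: "\<And>x. x \<in> X \<Longrightarrow> \<phi> x \<in> hom C (c x) (d (f x))"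
    and u\<phi>: "\<And>x. x \<in> X \<Longrightarrow> cmp C (c x) (csum K X c) (csum K Y d) u (incl K X c x)
      = cmp C (c x) (d (f x)) (csum K Y d) (incl K Y d (f x)) (\<phi> x)"
  shows "cmp C (csum K X c) (csum K Y d) (copow Y) (sigma C K one (Y, d)) u
    = cmp C (csum K X c) (copow X) (copow Y) (on_hom (copower_functor C K one) X Y f) (sigma C K one (X, c))"
proof (rule csum_ext[OF X])
  fix x assume x: "x \<in> X"
  have [simp]: "c x \<in> ob C" "d (f x) \<in> ob C" "\<phi> x \<in> hom C (c x) (d (f x))" "f x \<in> Y"
    using X Y f[OF x] \<phi>[OF x] x by auto
  have "cmp C (c x) (csum K X c) (copow Y)
        (cmp C (csum K X c) (csum K Y d) (copow Y) (sigma C K one (Y, d)) u) (incl K X c x)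
      = cmp C (c x) (d (f x)) (copow Y)
        (cmp C (d (f x)) one (copow Y) (incl K Y (points Y) (f x)) (bang (d (f x)))) (\<phi> x)"
    using X Y u x u\<phi>[OF x] by (simp add: assoc[of "c x" "csum K X c", symmetric] assoc[of "c x" "d (f x)"] sigma_incl)
  also have "\<dots> = cmp C (c x) one (copow Y) (incl K Y (points Y) (f x))
        (cmp C (c x) (d (f x)) one (bang (d (f x))) (\<phi> x))"
    using Y by (simp add: assoc)
  also have "cmp C (c x) (d (f x)) one (bang (d (f x))) (\<phi> x) = bang (c x)"
    by (intro bang_unique comp_in) auto
  also have "cmp C (c x) one (copow Y) (incl K Y (points Y) (f x)) (bang (c x))
      = cmp C (c x) (csum K X c) (copow Y) (cmp C (csum K X c) (copow X) (copow Y)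
        (on_hom (copower_functor C K one) X Y f) (sigma C K one (X, c))) (incl K X c x)"
    by (rule copower_sigma_incl[OF X Y(1) f x, symmetric])
  finally show "cmp C (c x) (csum K X c) (copow Y)
        (cmp C (csum K X c) (csum K Y d) (copow Y) (sigma C K one (Y, d)) u) (incl K X c x)
      = cmp C (c x) (csum K X c) (copow Y) (cmp C (csum K X c) (copow X) (copow Y)
        (on_hom (copower_functor C K one) X Y f) (sigma C K one (X, c))) (incl K X c x)" .
qed (use X Y f u copower_in[of X Y f] in \<open>simp_all add: comp_in\<close>)

lemma square_is_lax:
  "lax_square (Fam C U) C (set_cat U) C (sum_functor C K) index_functor id_functor
    (copower_functor C K one) (sigma C K one)"
  unfolding lax_square_def natural_transformation_def
proof (intro conjI ballI sum_functor_is_functor index_functor_is_functor id_functor_is_functor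
    copower_is_functor)
  fix a assume "a \<in> ob (Fam C U)"
  then show "sigma C K one a \<in> hom C (on_ob (comp_functor id_functor (sum_functor C K)) a)
      (on_ob (comp_functor (copower_functor C K one) index_functor) a)"
    by (auto simp: Fam_def comp_functor_def id_functor_def sum_functor_def copower_functor_def
        index_functor_def)
next
  fix a b f assume "a \<in> ob (Fam C U)" "b \<in> ob (Fam C U)" "f \<in> hom (Fam C U) a b"
  then obtain X c Y d g \<phi> where eqs: "a = (X, c)" "b = (Y, d)" "f = (g, \<phi>)"
    and X: "X \<in> U" "c \<in> X \<rightarrow>\<^sub>E ob C" and Y: "Y \<in> U" "d \<in> Y \<rightarrow>\<^sub>E ob C"
    and g: "\<And>x. x \<in> X \<Longrightarrow> g x \<in> Y" "\<And>x. x \<in> X \<Longrightarrow> \<phi> x \<in> hom C (c x) (d (g x))"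
    by (auto simp: Fam_def PiE_iff)
  show "cmp C (on_ob (comp_functor id_functor (sum_functor C K)) a)
        (on_ob (comp_functor id_functor (sum_functor C K)) b)
        (on_ob (comp_functor (copower_functor C K one) index_functor) b) (sigma C K one b)
        (on_hom (comp_functor id_functor (sum_functor C K)) a b f) =
      cmp C (on_ob (comp_functor id_functor (sum_functor C K)) a)
        (on_ob (comp_functor (copower_functor C K one) index_functor) a)
        (on_ob (comp_functor (copower_functor C K one) index_functor) b)
        (on_hom (comp_functor (copower_functor C K one) index_functor) a b f) (sigma C K one a)"
    using sigma_natural[OF X Y g(1) sum_functor_in[OF X Y g] g(2) sum_functor_incl[OF X Y g]]
    by (simp add: eqs comp_functor_def id_functor_def index_functor_def)
      (simp add: sum_functor_def copower_functor_def)
qed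

section \<open>Elementary forms of the two equivalences\<close>

text \<open>
  The square with sides \<open>d y \<rightarrow> \<Sum>d\<close> and \<open>1 \<rightarrow> Y * 1\<close> is a pullback: the cone condition on
  \<open>c \<rightarrow> 1\<close> is automatic, so only the leg \<open>g : c \<rightarrow> \<Sum>d\<close> is quantified.
\<close>

definition cartesian_coprojections :: bool where
  "cartesian_coprojections \<longleftrightarrow>
    (\<forall>Y\<in>U. \<forall>d\<in>Y \<rightarrow>\<^sub>E ob C. \<forall>y\<in>Y. \<forall>c\<in>ob C. \<forall>g\<in>hom C c (csum K Y d).
      cmp C c (csum K Y d) (copow Y) (sigma C K one (Y, d)) g
        = cmp C c one (copow Y) (incl K Y (points Y) y) (bang c) \<longrightarrow>
      (\<exists>!\<phi>. \<phi> \<in> hom C c (d y) \<and> cmp C c (d y) (csum K Y d) (incl K Y d y) \<phi> = g))"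

definition decomposable_over_copowers :: bool where
  "decomposable_over_copowers \<longleftrightarrow>
    (\<forall>X\<in>U. \<forall>a\<in>ob C. \<forall>p\<in>hom C a (copow X).
      \<exists>c\<in>X \<rightarrow>\<^sub>E ob C. \<exists>e. isomorphism C (csum K X c) a e \<and>
        cmp C (csum K X c) a (copow X) p e = sigma C K one (X, c))"

text \<open>The square of \<open>cartesian_coprojections\<close> commutes, because
  \<open>c \<rightarrow> d y \<rightarrow> 1\<close> is the unique morphism. Thus whatever factors
  through the coprojection at \<open>y\<close> meets the cone condition there.\<close>

lemma sigma_incl_comp:
  assumes Y: "Y \<in> U" "d \<in> Y \<rightarrow>\<^sub>E ob C" "y \<in> Y" and c: "c \<in> ob C" and \<phi>: "\<phi> \<in> hom C c (d y)"
  shows "cmp C c (csum K Y d) (copow Y) (sigma C K one (Y, d)) (cmp C c (d y) (csum K Y d) (incl K Y d y) \<phi>)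
    = cmp C c one (copow Y) (incl K Y (points Y) y) (bang c)"
proof -
  have dy: "d y \<in> ob C" using Y by auto
  have "cmp C c (csum K Y d) (copow Y) (sigma C K one (Y, d)) (cmp C c (d y) (csum K Y d) (incl K Y d y) \<phi>)
    = cmp C c one (copow Y) (incl K Y (points Y) y) (cmp C c (d y) one (bang (d y)) \<phi>)"
    using Y c \<phi> dy by (simp add: assoc sigma_incl)
  also have "cmp C c (d y) one (bang (d y)) \<phi> = bang c"
    using c \<phi> dy by (intro bang_unique comp_in) auto
  finally show ?thesis .
qed

lemma cartesian_lift:
  assumes "cartesian_coprojections" "Y \<in> U" "d \<in> Y \<rightarrow>\<^sub>E ob C" "y \<in> Y" "c \<in> ob C" "g \<in> hom C c (csum K Y d)"
    and "cmp C c (csum K Y d) (copow Y) (sigma C K one (Y, d)) g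
        = cmp C c one (copow Y) (incl K Y (points Y) y) (bang c)"
  shows "\<exists>\<phi>. \<phi> \<in> hom C c (d y) \<and> cmp C c (d y) (csum K Y d) (incl K Y d y) \<phi> = g"
  using assms(1)[unfolded cartesian_coprojections_def, rule_format, OF assms(2-)] by (rule ex1_implies_ex)

text \<open>The common composite satisfies the cone condition by \<open>sigma_incl_comp\<close>, so
  the uniqueness part of the pullback property applies. In effect, coprojections are monic.\<close>

lemma cartesian_mono:
  assumes P: "cartesian_coprojections" and Y: "Y \<in> U" "d \<in> Y \<rightarrow>\<^sub>E ob C" "y \<in> Y" and c: "c \<in> ob C"
    and \<phi>: "\<phi> \<in> hom C c (d y)" "\<psi> \<in> hom C c (d y)"
    and eq: "cmp C c (d y) (csum K Y d) (incl K Y d y) \<phi> = cmp C c (d y) (csum K Y d) (incl K Y d y) \<psi>"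
  shows "\<phi> = \<psi>"
proof -
  have "d y \<in> ob C" using Y by auto
  then have "cmp C c (d y) (csum K Y d) (incl K Y d y) \<phi> \<in> hom C c (csum K Y d)"
    using Y c \<phi> by (auto intro: comp_in)
  then have "\<exists>!\<chi>. \<chi> \<in> hom C c (d y) \<and>
      cmp C c (d y) (csum K Y d) (incl K Y d y) \<chi> = cmp C c (d y) (csum K Y d) (incl K Y d y) \<phi>"
    using P[unfolded cartesian_coprojections_def, rule_format, OF Y c] sigma_incl_comp[OF Y c \<phi>(1)]
    by simp
  with \<phi> eq show ?thesis by metis
qed

text \<open>A morphism out of a sum amounts to its restrictions, so lifting \<open>u\<close> along
  \<open>sum_functor\<close> becomes one factorisation through a coprojection for each
  \<open>x\<close>, the shape to which the pullback property applies.\<close>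

lemma sum_functor_eq_iff:
  assumes X: "X \<in> U" "c \<in> X \<rightarrow>\<^sub>E ob C" and Y: "Y \<in> U" "d \<in> Y \<rightarrow>\<^sub>E ob C"
    and f: "\<And>x. x \<in> X \<Longrightarrow> f x \<in> Y" and \<phi>: "\<And>x. x \<in> X \<Longrightarrow> \<phi> x \<in> hom C (c x) (d (f x))"
    and u: "u \<in> hom C (csum K X c) (csum K Y d)"
  shows "on_hom (sum_functor C K) (X, c) (Y, d) (f, \<phi>) = u \<longleftrightarrow>
    (\<forall>x\<in>X. cmp C (c x) (csum K X c) (csum K Y d) u (incl K X c x)
      = cmp C (c x) (d (f x)) (csum K Y d) (incl K Y d (f x)) (\<phi> x))"
  using sum_functor_in[OF X Y f \<phi>] sum_functor_incl[OF X Y f \<phi>] u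
    csum_ext[OF X csum_ob[OF Y], of "on_hom (sum_functor C K) (X, c) (Y, d) (f, \<phi>)" u]
  by auto

lemma sum_hom_eq_iff:
  assumes X: "X \<in> U" "c \<in> X \<rightarrow>\<^sub>E ob C" "d \<in> X \<rightarrow>\<^sub>E ob C"
    and \<phi>: "\<And>x. x \<in> X \<Longrightarrow> \<phi> x \<in> hom C (c x) (d x)" and u: "u \<in> hom C (csum K X c) (csum K X d)"
  shows "sum_hom C K X c d \<phi> = u \<longleftrightarrow>
    (\<forall>x\<in>X. cmp C (c x) (csum K X c) (csum K X d) u (incl K X c x)
      = cmp C (c x) (d x) (csum K X d) (incl K X d x) (\<phi> x))"
  using sum_functor_eq_iff[OF X(1,2) X(1,3), of "\<lambda>x\<in>X. x" \<phi> u] \<phi> u by (simp add: sum_hom_def)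

text \<open>\<open>\<chi>\<close> is tied to the composite pointwise on \<open>X\<close>. Hence the
  same lemma covers restricted composites, the structure maps \<open>p i\<close> of objects of
  slices, and the maps to the terminal object inside \<open>sigma\<close>.\<close>

lemma sum_hom_comp:
  assumes X: "X \<in> U" "c \<in> X \<rightarrow>\<^sub>E ob C" "d \<in> X \<rightarrow>\<^sub>E ob C" "e \<in> X \<rightarrow>\<^sub>E ob C"
    and \<phi>: "\<And>x. x \<in> X \<Longrightarrow> \<phi> x \<in> hom C (c x) (d x)" and \<psi>: "\<And>x. x \<in> X \<Longrightarrow> \<psi> x \<in> hom C (d x) (e x)"
    and \<chi>: "\<And>x. x \<in> X \<Longrightarrow> \<chi> x = cmp C (c x) (d x) (e x) (\<psi> x) (\<phi> x)"
  shows "sum_hom C K X c e \<chi>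
    = cmp C (csum K X c) (csum K X d) (csum K X e) (sum_hom C K X d e \<psi>) (sum_hom C K X c d \<phi>)"
proof -
  note f = sum_hom_in[OF X(1,2,3) \<phi>] sum_hom_incl[OF X(1,2,3) \<phi>]
    and g = sum_hom_in[OF X(1,3,4) \<psi>] sum_hom_incl[OF X(1,3,4) \<psi>]
  have ob: "c x \<in> ob C" "d x \<in> ob C" "e x \<in> ob C" if "x \<in> X" for x using X that by auto
  have "cmp C (c x) (csum K X c) (csum K X e) (cmp C (csum K X c) (csum K X d) (csum K X e)
        (sum_hom C K X d e \<psi>) (sum_hom C K X c d \<phi>)) (incl K X c x)
      = cmp C (c x) (e x) (csum K X e) (incl K X e x) (\<chi> x)" if x: "x \<in> X" for x
  proof -
    have "cmp C (c x) (csum K X c) (csum K X e) (cmp C (csum K X c) (csum K X d) (csum K X e)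
        (sum_hom C K X d e \<psi>) (sum_hom C K X c d \<phi>)) (incl K X c x)
      = cmp C (c x) (csum K X d) (csum K X e) (sum_hom C K X d e \<psi>)
          (cmp C (c x) (d x) (csum K X d) (incl K X d x) (\<phi> x))"
      using X ob[OF x] f g x by (simp add: assoc[symmetric])
    also have "\<dots> = cmp C (c x) (d x) (csum K X e)
        (cmp C (d x) (e x) (csum K X e) (incl K X e x) (\<psi> x)) (\<phi> x)"
      using X ob[OF x] \<phi>[OF x] g x by (simp add: assoc)
    also have "\<dots> = cmp C (c x) (e x) (csum K X e) (incl K X e x) (\<chi> x)"
      using X ob[OF x] \<phi>[OF x] \<psi>[OF x] \<chi>[OF x] x by (simp add: assoc)
    finally show ?thesis .
  qed
  then show ?thesis
    using X ob f(1) g(1) \<phi> \<psi> \<chi> by (subst sum_hom_eq_iff) (auto intro!: comp_in)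
qed

lemma sigma_eq_sum_hom: "sigma C K one (X, c) = sum_hom C K X c (points X) (\<lambda>x\<in>X. bang (c x))"
  by (simp add: sigma_def)

text \<open>This is \<open>sum_hom_comp\<close> for
  \<open>c x \<rightarrow> d x \<rightarrow> 1\<close>. It places sums of morphisms with a fixed
  index set over \<open>X * 1\<close>, the base over which decompositions are taken.\<close>

lemma sigma_sum_hom:
  assumes X: "X \<in> U" "c \<in> X \<rightarrow>\<^sub>E ob C" "d \<in> X \<rightarrow>\<^sub>E ob C" and \<phi>: "\<And>x. x \<in> X \<Longrightarrow> \<phi> x \<in> hom C (c x) (d x)"
  shows "cmp C (csum K X c) (csum K X d) (copow X) (sigma C K one (X, d)) (sum_hom C K X c d \<phi>)
    = sigma C K one (X, c)"
  unfolding sigma_eq_sum_hom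
proof (rule sum_hom_comp[OF X, symmetric])
  fix x assume x: "x \<in> X"
  then have "c x \<in> ob C" "d x \<in> ob C" using X by auto
  with x \<phi>[OF x] show "(\<lambda>x\<in>X. bang (c x)) x = cmp C (c x) (d x) (points X x) ((\<lambda>x\<in>X. bang (d x)) x) (\<phi> x)"
    by (auto intro!: bang_unique[symmetric] comp_in)
qed (use X \<phi> in \<open>auto simp: PiE_iff\<close>)

section \<open>The comma category of the square and the comparison functor, in coordinates\<close>

abbreviation square_comma :: "('o \<times> 'i set \<times> 'm, 'm \<times> ('i \<Rightarrow> 'i)) cat" where
  "square_comma \<equiv> comma C (set_cat U) C id_functor (copower_functor C K one)"

abbreviation square_functor ::
  "('i set \<times> ('i \<Rightarrow> 'o), ('i \<Rightarrow> 'i) \<times> ('i \<Rightarrow> 'm), 'o \<times> 'i set \<times> 'm, 'm \<times> ('i \<Rightarrow> 'i)) functor_data" where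
  "square_functor \<equiv> comma_functor (sum_functor C K) index_functor (sigma C K one)"

lemma square_comma_ob:
  "(a, X, p) \<in> ob square_comma \<longleftrightarrow> a \<in> ob C \<and> X \<in> U \<and> p \<in> hom C a (copow X)"
  by (simp add: comma_def id_functor_def copower_functor_def set_cat_def)

lemma square_comma_hom:
  "(u, f) \<in> hom square_comma (a, X, p) (b, Y, q) \<longleftrightarrow> u \<in> hom C a b \<and> f \<in> X \<rightarrow>\<^sub>E Y \<and>
    cmp C a b (copow Y) q u = cmp C a (copow X) (copow Y) (on_hom (copower_functor C K one) X Y f) p"
  by (simp add: comma_def id_functor_def set_cat_def) (simp add: copower_functor_def)

lemma square_functor_ob: "on_ob square_functor (X, c) = (csum K X c, X, sigma C K one (X, c))"
  by (simp add: comma_functor_def sum_functor_def index_functor_def)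

lemma square_functor_hom:
  "on_hom square_functor (X, c) (Y, d) (f, \<phi>) = (on_hom (sum_functor C K) (X, c) (Y, d) (f, \<phi>), f)"
  by (simp add: comma_functor_def index_functor_def)

lemma Fam_ob: "(X, c) \<in> ob (Fam C U) \<longleftrightarrow> X \<in> U \<and> c \<in> X \<rightarrow>\<^sub>E ob C"
  by (simp add: Fam_def)

lemma Fam_hom:
  "(f, \<phi>) \<in> hom (Fam C U) (X, c) (Y, d) \<longleftrightarrow> f \<in> X \<rightarrow>\<^sub>E Y \<and> \<phi> \<in> (\<Pi>\<^sub>E x\<in>X. hom C (c x) (d (f x)))"
  by (simp add: Fam_def)

text \<open>The second component of the image is the index function itself, so \<open>g\<close> is
  prescribed by \<open>f\<close> and the family \<open>\<phi>\<close> is what remains to be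
  found.\<close>

lemma square_functor_hom_eq_iff:
  assumes X: "X \<in> U" "c \<in> X \<rightarrow>\<^sub>E ob C" and Y: "Y \<in> U" "d \<in> Y \<rightarrow>\<^sub>E ob C"
    and u: "u \<in> hom C (csum K X c) (csum K Y d)"
  shows "(g, \<phi>) \<in> hom (Fam C U) (X, c) (Y, d) \<and> on_hom square_functor (X, c) (Y, d) (g, \<phi>) = (u, f) \<longleftrightarrow>
    g = f \<and> f \<in> X \<rightarrow>\<^sub>E Y \<and> \<phi> \<in> (\<Pi>\<^sub>E x\<in>X. hom C (c x) (d (f x))) \<and>
    (\<forall>x\<in>X. cmp C (c x) (csum K X c) (csum K Y d) u (incl K X c x)
      = cmp C (c x) (d (f x)) (csum K Y d) (incl K Y d (f x)) (\<phi> x))"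
\<comment> \<open>The case condition supplies the typing under which
  \<open>sum_functor_eq_iff\<close> applies; when it fails, both sides are false.\<close>
proof (cases "g = f \<and> f \<in> X \<rightarrow>\<^sub>E Y \<and> \<phi> \<in> (\<Pi>\<^sub>E x\<in>X. hom C (c x) (d (f x)))")
  case True
  then have "x \<in> X \<Longrightarrow> f x \<in> Y" "x \<in> X \<Longrightarrow> \<phi> x \<in> hom C (c x) (d (f x))" for x by auto
  from sum_functor_eq_iff[OF X Y this u] True show ?thesis
    by (simp add: Fam_hom square_functor_hom)
next
  case False
  then show ?thesis by (auto simp add: Fam_hom square_functor_hom)
qed

text \<open>Removes a forced component from a unique existence; the index function will be that
  component.\<close>

lemma ex1_pair_iff:
  assumes "\<And>a b. P (a, b) \<longleftrightarrow> a = c \<and> Q b"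
  shows "(\<exists>!k. P k) \<longleftrightarrow> (\<exists>!b. Q b)"
proof -
  have "P k \<longleftrightarrow> fst k = c \<and> Q (snd k)" for k using assms[of "fst k" "snd k"] by simp
  then show ?thesis by (metis prod.collapse fst_conv snd_conv)
qed

text \<open>A morphism of the comma category between sums is a \<open>u\<close> together with an
  index function \<open>f\<close> that it covers, and a preimage is a splitting of \<open>u\<close>
  into components \<open>c x \<rightarrow> d (f x)\<close>.\<close>

lemma square_functor_fully_faithful_iff:
  "fully_faithful (Fam C U) square_comma square_functor \<longleftrightarrow>
    (\<forall>X\<in>U. \<forall>c\<in>X \<rightarrow>\<^sub>E ob C. \<forall>Y\<in>U. \<forall>d\<in>Y \<rightarrow>\<^sub>E ob C. \<forall>f\<in>X \<rightarrow>\<^sub>E Y. \<forall>u\<in>hom C (csum K X c) (csum K Y d).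
      cmp C (csum K X c) (csum K Y d) (copow Y) (sigma C K one (Y, d)) u
        = cmp C (csum K X c) (copow X) (copow Y) (on_hom (copower_functor C K one) X Y f) (sigma C K one (X, c)) \<longrightarrow>
      (\<exists>!\<phi>. \<phi> \<in> (\<Pi>\<^sub>E x\<in>X. hom C (c x) (d (f x))) \<and>
        (\<forall>x\<in>X. cmp C (c x) (csum K X c) (csum K Y d) u (incl K X c x)
          = cmp C (c x) (d (f x)) (csum K Y d) (incl K Y d (f x)) (\<phi> x))))"
    (is "?L \<longleftrightarrow> ?R")
proof -
  have *: "(\<exists>!k. k \<in> hom (Fam C U) (X, c) (Y, d) \<and> on_hom square_functor (X, c) (Y, d) k = (u, f)) \<longleftrightarrow>
      (\<exists>!\<phi>. \<phi> \<in> (\<Pi>\<^sub>E x\<in>X. hom C (c x) (d (f x))) \<and>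
        (\<forall>x\<in>X. cmp C (c x) (csum K X c) (csum K Y d) u (incl K X c x)
          = cmp C (c x) (d (f x)) (csum K Y d) (incl K Y d (f x)) (\<phi> x)))"
    if "X \<in> U" "c \<in> X \<rightarrow>\<^sub>E ob C" "Y \<in> U" "d \<in> Y \<rightarrow>\<^sub>E ob C" "u \<in> hom C (csum K X c) (csum K Y d)"
      "f \<in> X \<rightarrow>\<^sub>E Y" for X c Y d u f
    by (rule ex1_pair_iff) (use square_functor_hom_eq_iff[OF that(1-5), of _ _ f] that(6) in simp)
  show ?thesis
    unfolding fully_faithful_def
  proof (intro iffI ballI impI)
    fix X c Y d f u
    assume L: "\<forall>a\<in>ob (Fam C U). \<forall>b\<in>ob (Fam C U).
        \<forall>h\<in>hom square_comma (on_ob square_functor a) (on_ob square_functor b).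
        \<exists>!k. k \<in> hom (Fam C U) a b \<and> on_hom square_functor a b k = h"
      and X: "X \<in> U" "c \<in> X \<rightarrow>\<^sub>E ob C" "Y \<in> U" "d \<in> Y \<rightarrow>\<^sub>E ob C" and f: "f \<in> X \<rightarrow>\<^sub>E Y"
      and u: "u \<in> hom C (csum K X c) (csum K Y d)"
      and eq: "cmp C (csum K X c) (csum K Y d) (copow Y) (sigma C K one (Y, d)) u
        = cmp C (csum K X c) (copow X) (copow Y) (on_hom (copower_functor C K one) X Y f) (sigma C K one (X, c))"
    have "(u, f) \<in> hom square_comma (on_ob square_functor (X, c)) (on_ob square_functor (Y, d))"
      unfolding square_functor_ob square_comma_hom using f u eq by blast
    with L X have "\<exists>!k. k \<in> hom (Fam C U) (X, c) (Y, d) \<and> on_hom square_functor (X, c) (Y, d) k = (u, f)"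
      by (simp only: Fam_ob)
    then show "\<exists>!\<phi>. \<phi> \<in> (\<Pi>\<^sub>E x\<in>X. hom C (c x) (d (f x))) \<and>
        (\<forall>x\<in>X. cmp C (c x) (csum K X c) (csum K Y d) u (incl K X c x)
          = cmp C (c x) (d (f x)) (csum K Y d) (incl K Y d (f x)) (\<phi> x))"
      using *[OF X u f] by blast
  next
    fix a b h
    assume R: ?R and a: "a \<in> ob (Fam C U)" and b: "b \<in> ob (Fam C U)"
      and h: "h \<in> hom square_comma (on_ob square_functor a) (on_ob square_functor b)"
    obtain X c Y d u f where eqs: "a = (X, c)" "b = (Y, d)" "h = (u, f)" by (metis prod.exhaust)
    have X: "X \<in> U" "c \<in> X \<rightarrow>\<^sub>E ob C" "Y \<in> U" "d \<in> Y \<rightarrow>\<^sub>E ob C" using a b by (simp_all add: eqs Fam_ob)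
    have h: "u \<in> hom C (csum K X c) (csum K Y d)" "f \<in> X \<rightarrow>\<^sub>E Y"
      "cmp C (csum K X c) (csum K Y d) (copow Y) (sigma C K one (Y, d)) u
        = cmp C (csum K X c) (copow X) (copow Y) (on_hom (copower_functor C K one) X Y f) (sigma C K one (X, c))"
      using h unfolding eqs square_functor_ob square_comma_hom by blast+
    have "\<exists>!k. k \<in> hom (Fam C U) (X, c) (Y, d) \<and> on_hom square_functor (X, c) (Y, d) k = (u, f)"
      unfolding *[OF X h(1,2)] using R X h by blast
    then show "\<exists>!k. k \<in> hom (Fam C U) a b \<and> on_hom square_functor a b k = h"
      unfolding eqs .
  qed
qed

lemma isomorphism_slice_iff:
  assumes x: "x \<in> ob C" and a: "a \<in> ob C" "p \<in> hom C a x" and b: "b \<in> ob C" "q \<in> hom C b x"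
  shows "isomorphism (slice C x) (a, p) (b, q) e \<longleftrightarrow> isomorphism C a b e \<and> cmp C a b x q e = p"
proof
  assume "isomorphism C a b e \<and> cmp C a b x q e = p"
  then obtain e' where e: "e \<in> hom C a b" "cmp C a b x q e = p" "e' \<in> hom C b a"
    "cmp C a b a e' e = idn C a" "cmp C b a b e e' = idn C b"
    unfolding isomorphism_def by blast
  \<comment> \<open>The inverse lies over \<open>x\<close> automatically: replace \<open>p\<close>
    by \<open>q\<close> after \<open>e\<close>, then cancel \<open>e\<close> against
    \<open>e'\<close>.\<close>
  have "cmp C b a x p e' = q"
    using e x a b by (simp add: assoc[symmetric] id_right flip: e(2))
  with e show "isomorphism (slice C x) (a, p) (b, q) e"
    unfolding isomorphism_def slice_def by auto
qed (auto simp: isomorphism_def slice_def)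

text \<open>The square for the inverse pair follows by conjugating the given one: the copower
  functor carries \<open>g'\<close> to a left inverse of the image of \<open>g\<close>.\<close>

lemma isomorphism_square_comma_iff:
  assumes X: "a \<in> ob C" "X \<in> U" "p \<in> hom C a (copow X)" and Y: "b \<in> ob C" "Y \<in> U" "q \<in> hom C b (copow Y)"
  shows "isomorphism square_comma (a, X, p) (b, Y, q) (e, g) \<longleftrightarrow>
    isomorphism C a b e \<and> isomorphism (set_cat U) X Y g \<and>
    cmp C a b (copow Y) q e = cmp C a (copow X) (copow Y) (on_hom (copower_functor C K one) X Y g) p"
proof
  assume "isomorphism square_comma (a, X, p) (b, Y, q) (e, g)"
  then show "isomorphism C a b e \<and> isomorphism (set_cat U) X Y g \<and>
      cmp C a b (copow Y) q e = cmp C a (copow X) (copow Y) (on_hom (copower_functor C K one) X Y g) p"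
    unfolding isomorphism_def comma_def by (auto simp: id_functor_def copower_functor_def)
next
  assume asm: "isomorphism C a b e \<and> isomorphism (set_cat U) X Y g \<and>
      cmp C a b (copow Y) q e = cmp C a (copow X) (copow Y) (on_hom (copower_functor C K one) X Y g) p"
  let ?T = "on_hom (copower_functor C K one)"
  have on_ob: "on_ob (copower_functor C K one) Z = copow Z" for Z by (simp add: copower_functor_def)
  from asm obtain e' g' where e: "e \<in> hom C a b" "e' \<in> hom C b a"
      "cmp C a b a e' e = idn C a" "cmp C b a b e e' = idn C b"
    and g: "g \<in> hom (set_cat U) X Y" "g' \<in> hom (set_cat U) Y X"
      "cmp (set_cat U) X Y X g' g = idn (set_cat U) X" "cmp (set_cat U) Y X Y g g' = idn (set_cat U) Y"
    and eq: "cmp C a b (copow Y) q e = cmp C a (copow X) (copow Y) (?T X Y g) p"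
    unfolding isomorphism_def by blast
  have ob: "X \<in> ob (set_cat U)" "Y \<in> ob (set_cat U)" using X Y by (simp_all add: set_cat_def)
  have T: "?T X Y g \<in> hom C (copow X) (copow Y)" "?T Y X g' \<in> hom C (copow Y) (copow X)"
    using functor_hom[OF copower_is_functor ob g(1)] functor_hom[OF copower_is_functor ob(2,1) g(2)]
    by (simp_all only: on_ob)
  have TT: "cmp C (copow X) (copow Y) (copow X) (?T Y X g') (?T X Y g) = idn C (copow X)"
    using functor_comp[OF copower_is_functor ob(1,2,1) g(1,2)] functor_id[OF copower_is_functor ob(1)] g(3)
    by (simp only: on_ob)
  have "cmp C b (copow Y) (copow X) (?T Y X g') q
      = cmp C b (copow Y) (copow X) (?T Y X g') (cmp C b a (copow Y) (cmp C a b (copow Y) q e) e')"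
    using X Y e by (simp add: assoc[symmetric] id_right)
  also have "\<dots> = cmp C b a (copow X) (cmp C a (copow X) (copow X)
      (cmp C (copow X) (copow Y) (copow X) (?T Y X g') (?T X Y g)) p) e'"
    using X Y e T by (simp add: eq assoc comp_in)
  also have "\<dots> = cmp C b a (copow X) p e'"
    using X Y e by (simp add: TT id_left)
  finally have "(e', g') \<in> hom square_comma (b, Y, q) (a, X, p)"
    unfolding square_comma_hom using e g by (simp add: set_cat_def)
  moreover have "(e, g) \<in> hom square_comma (a, X, p) (b, Y, q)"
    unfolding square_comma_hom using e g eq by (simp add: set_cat_def)
  ultimately show "isomorphism square_comma (a, X, p) (b, Y, q) (e, g)"
    unfolding isomorphism_def by (intro conjI bexI[of _ "(e', g')"]) (simp_all add: comma_def e g)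
qed

section \<open>Slices, products of slices and the sum functor between them, in coordinates\<close>

lemma slice_ob: "(a, p) \<in> ob (slice C x) \<longleftrightarrow> a \<in> ob C \<and> p \<in> hom C a x"
  by (simp add: slice_def)

lemma slice_hom:
  "u \<in> hom (slice C x) (a, p) (b, q) \<longleftrightarrow> u \<in> hom C a b \<and> cmp C a b x q u = p"
  by (simp add: slice_def)

lemma prod_slice_ob:
  "(\<lambda>i\<in>I. (c i, p i)) \<in> ob (prod_cat I (\<lambda>i. slice C (X i))) \<longleftrightarrow>
    (\<forall>i\<in>I. c i \<in> ob C \<and> p i \<in> hom C (c i) (X i))"
  by (auto simp: prod_cat_def slice_def PiE_iff)

text \<open>Extensionality makes the splitting of \<open>A\<close> into objects and structure maps a
  literal equality, with \<open>c\<close> a family to which the coproduct lemmas apply.\<close>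

lemma prod_slice_obE:
  assumes "A \<in> ob (prod_cat I (\<lambda>i. slice C (X i)))"
  obtains c p where "A = (\<lambda>i\<in>I. (c i, p i))" "c \<in> I \<rightarrow>\<^sub>E ob C" "p \<in> (\<Pi>\<^sub>E i\<in>I. hom C (c i) (X i))"
proof
  show "A = (\<lambda>i\<in>I. ((\<lambda>i\<in>I. fst (A i)) i, (\<lambda>i\<in>I. snd (A i)) i))"
    using assms by (auto simp: prod_cat_def PiE_iff extensional_def fun_eq_iff)
qed (use assms in \<open>auto simp: prod_cat_def slice_def PiE_iff split_beta extensional_def\<close>)

lemma prod_slice_hom:
  "\<phi> \<in> hom (prod_cat I (\<lambda>i. slice C (X i))) (\<lambda>i\<in>I. (c i, p i)) (\<lambda>i\<in>I. (d i, q i)) \<longleftrightarrow>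
    \<phi> \<in> (\<Pi>\<^sub>E i\<in>I. hom C (c i) (d i)) \<and> (\<forall>i\<in>I. cmp C (c i) (d i) (X i) (q i) (\<phi> i) = p i)"
  by (auto simp: prod_cat_def slice_def PiE_iff)

lemma slice_sum_ob:
  "c \<in> extensional I \<Longrightarrow> p \<in> extensional I \<Longrightarrow>
    on_ob (slice_sum C K I X) (\<lambda>i\<in>I. (c i, p i)) = (csum K I c, sum_hom C K I c X p)"
  by (simp add: slice_sum_def extensional_restrict cong: restrict_cong)

lemma slice_sum_hom:
  "c \<in> extensional I \<Longrightarrow> d \<in> extensional I \<Longrightarrow>
    on_hom (slice_sum C K I X) (\<lambda>i\<in>I. (c i, p i)) (\<lambda>i\<in>I. (d i, q i)) \<phi> = sum_hom C K I c d \<phi>"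
  by (simp add: slice_sum_def extensional_restrict cong: restrict_cong)

text \<open>\<open>sum_hom_comp\<close> is used twice: with target family \<open>X\<close> it shows
  that a sum of morphisms over the \<open>X i\<close> is a morphism over their sum, and with a third
  object of the product it gives preservation of composition.\<close>

lemma slice_sum_is_functor:
  assumes I: "I \<in> U" and X: "X \<in> I \<rightarrow>\<^sub>E ob C"
  shows "is_functor (prod_cat I (\<lambda>i. slice C (X i))) (slice C (csum K I X)) (slice_sum C K I X)"
proof (rule functorI)
  let ?P = "prod_cat I (\<lambda>i. slice C (X i))"
  fix A assume "A \<in> ob ?P"
  then obtain c p where A: "A = (\<lambda>i\<in>I. (c i, p i))" and c: "c \<in> I \<rightarrow>\<^sub>E ob C"
    and p: "p \<in> (\<Pi>\<^sub>E i\<in>I. hom C (c i) (X i))"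
    by (rule prod_slice_obE)
  have ext: "c \<in> extensional I" "p \<in> extensional I" using c p by (auto simp: PiE_iff)
  have "sum_hom C K I c X p \<in> hom C (csum K I c) (csum K I X)"
    by (rule sum_hom_in[OF I c X]) (use p in auto)
  then show "on_ob (slice_sum C K I X) A \<in> ob (slice C (csum K I X))"
    using I c by (simp add: A slice_sum_ob ext slice_ob)
  have "idn ?P A = (\<lambda>i\<in>I. idn C (c i))"
    by (auto simp: A prod_cat_def slice_def)
  moreover have "sum_hom C K I c c (\<lambda>i\<in>I. idn C (c i)) = idn C (csum K I c)"
  proof (subst sum_hom_eq_iff[OF I c c])
    have "c i \<in> ob C" if "i \<in> I" for i using c that by auto
    then show "\<forall>i\<in>I. cmp C (c i) (csum K I c) (csum K I c) (idn C (csum K I c)) (incl K I c i) =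
        cmp C (c i) (c i) (csum K I c) (incl K I c i) ((\<lambda>i\<in>I. idn C (c i)) i)"
      using I c by (simp add: id_left id_right)
  qed (use I c in \<open>auto intro!: id_in\<close>)
  ultimately show "on_hom (slice_sum C K I X) A A (idn ?P A)
      = idn (slice C (csum K I X)) (on_ob (slice_sum C K I X) A)"
    unfolding A slice_sum_ob[OF ext] slice_sum_hom[OF ext(1) ext(1)] by (simp add: slice_def)
next
  let ?P = "prod_cat I (\<lambda>i. slice C (X i))"
  fix A B \<phi> assume A: "A \<in> ob ?P" and B: "B \<in> ob ?P" and \<phi>: "\<phi> \<in> hom ?P A B"
  from A obtain c p where A: "A = (\<lambda>i\<in>I. (c i, p i))" and c: "c \<in> I \<rightarrow>\<^sub>E ob C" "p \<in> (\<Pi>\<^sub>E i\<in>I. hom C (c i) (X i))"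
    by (rule prod_slice_obE)
  from B obtain d q where B: "B = (\<lambda>i\<in>I. (d i, q i))" and d: "d \<in> I \<rightarrow>\<^sub>E ob C" "q \<in> (\<Pi>\<^sub>E i\<in>I. hom C (d i) (X i))"
    by (rule prod_slice_obE)
  have ext: "c \<in> extensional I" "p \<in> extensional I" "d \<in> extensional I" "q \<in> extensional I"
    using c d by (auto simp: PiE_iff)
  from \<phi> have \<phi>: "\<And>i. i \<in> I \<Longrightarrow> \<phi> i \<in> hom C (c i) (d i)"
    "\<And>i. i \<in> I \<Longrightarrow> p i = cmp C (c i) (d i) (X i) (q i) (\<phi> i)"
    unfolding A B prod_slice_hom by auto
  have q: "\<And>i. i \<in> I \<Longrightarrow> q i \<in> hom C (d i) (X i)" using d by auto
  show "on_hom (slice_sum C K I X) A B \<phi>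
      \<in> hom (slice C (csum K I X)) (on_ob (slice_sum C K I X) A) (on_ob (slice_sum C K I X) B)"
    unfolding A B slice_sum_ob[OF ext(1,2)] slice_sum_ob[OF ext(3,4)] slice_sum_hom[OF ext(1,3)] slice_hom
    using sum_hom_in[OF I c(1) d(1) \<phi>(1)] sum_hom_comp[OF I c(1) d(1) X \<phi>(1) q \<phi>(2)] by simp
next
  let ?P = "prod_cat I (\<lambda>i. slice C (X i))"
  fix A B D \<phi> \<psi>
  assume A: "A \<in> ob ?P" and B: "B \<in> ob ?P" and D: "D \<in> ob ?P" and \<phi>: "\<phi> \<in> hom ?P A B" and \<psi>: "\<psi> \<in> hom ?P B D"
  from A obtain c p where A_eq: "A = (\<lambda>i\<in>I. (c i, p i))" and c: "c \<in> I \<rightarrow>\<^sub>E ob C" "p \<in> (\<Pi>\<^sub>E i\<in>I. hom C (c i) (X i))"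
    by (rule prod_slice_obE)
  from B obtain d q where B_eq: "B = (\<lambda>i\<in>I. (d i, q i))" and d: "d \<in> I \<rightarrow>\<^sub>E ob C" "q \<in> (\<Pi>\<^sub>E i\<in>I. hom C (d i) (X i))"
    by (rule prod_slice_obE)
  from D obtain e r where D_eq: "D = (\<lambda>i\<in>I. (e i, r i))" and e: "e \<in> I \<rightarrow>\<^sub>E ob C" "r \<in> (\<Pi>\<^sub>E i\<in>I. hom C (e i) (X i))"
    by (rule prod_slice_obE)
  note eqs = A_eq B_eq D_eq
  have ext: "c \<in> extensional I" "p \<in> extensional I" "d \<in> extensional I" "q \<in> extensional I"
    "e \<in> extensional I" "r \<in> extensional I"
    using c d e by (auto simp: PiE_iff)
  have \<phi>: "\<And>i. i \<in> I \<Longrightarrow> \<phi> i \<in> hom C (c i) (d i)" and \<psi>: "\<And>i. i \<in> I \<Longrightarrow> \<psi> i \<in> hom C (d i) (e i)"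
    using \<phi> \<psi> unfolding eqs prod_slice_hom by auto
  have "cmp ?P A B D \<psi> \<phi> = (\<lambda>i\<in>I. cmp C (c i) (d i) (e i) (\<psi> i) (\<phi> i))"
    by (auto simp: eqs prod_cat_def slice_def)
  moreover have "cmp (slice C (csum K I X)) (csum K I c, sum_hom C K I c X p)
      (csum K I d, sum_hom C K I d X q) (csum K I e, sum_hom C K I e X r)
      = cmp C (csum K I c) (csum K I d) (csum K I e)"
    by (simp add: slice_def)
  ultimately show "on_hom (slice_sum C K I X) A D (cmp ?P A B D \<psi> \<phi>) =
      cmp (slice C (csum K I X)) (on_ob (slice_sum C K I X) A) (on_ob (slice_sum C K I X) B)
        (on_ob (slice_sum C K I X) D) (on_hom (slice_sum C K I X) B D \<psi>) (on_hom (slice_sum C K I X) A B \<phi>)"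
    unfolding eqs slice_sum_ob[OF ext(1,2)] slice_sum_ob[OF ext(3,4)] slice_sum_ob[OF ext(5,6)]
      slice_sum_hom[OF ext(1,3)] slice_sum_hom[OF ext(3,5)] slice_sum_hom[OF ext(1,5)]
    using sum_hom_comp[OF I c(1) d(1) e(1) \<phi> \<psi>, of "\<lambda>i\<in>I. cmp C (c i) (d i) (e i) (\<psi> i) (\<phi> i)"]
    by simp
qed

text \<open>In contrast to \<open>Fam\<close>, no index function occurs: morphisms in the product of
  slices fix \<open>I\<close>. A single object must therefore be completed to a family over all of
  \<open>I\<close> before this can be applied to it.\<close>

lemma slice_sum_fully_faithful_iff:
  "fully_faithful (prod_cat I (\<lambda>i. slice C (X i))) (slice C (csum K I X)) (slice_sum C K I X) \<longleftrightarrow>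
    (\<forall>c\<in>I \<rightarrow>\<^sub>E ob C. \<forall>p\<in>(\<Pi>\<^sub>E i\<in>I. hom C (c i) (X i)). \<forall>d\<in>I \<rightarrow>\<^sub>E ob C. \<forall>q\<in>(\<Pi>\<^sub>E i\<in>I. hom C (d i) (X i)).
      \<forall>u\<in>hom C (csum K I c) (csum K I d).
      cmp C (csum K I c) (csum K I d) (csum K I X) (sum_hom C K I d X q) u = sum_hom C K I c X p \<longrightarrow>
      (\<exists>!\<phi>. (\<phi> \<in> (\<Pi>\<^sub>E i\<in>I. hom C (c i) (d i)) \<and> (\<forall>i\<in>I. cmp C (c i) (d i) (X i) (q i) (\<phi> i) = p i)) \<and>
        sum_hom C K I c d \<phi> = u))" (is "?L \<longleftrightarrow> ?R")
proof -
  let ?P = "prod_cat I (\<lambda>i. slice C (X i))"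
  show ?thesis
    unfolding fully_faithful_def
  proof (intro iffI ballI impI)
    fix c p d q u
    assume L: "\<forall>A\<in>ob ?P. \<forall>B\<in>ob ?P.
        \<forall>h\<in>hom (slice C (csum K I X)) (on_ob (slice_sum C K I X) A) (on_ob (slice_sum C K I X) B).
        \<exists>!\<phi>. \<phi> \<in> hom ?P A B \<and> on_hom (slice_sum C K I X) A B \<phi> = h"
      and c: "c \<in> I \<rightarrow>\<^sub>E ob C" "p \<in> (\<Pi>\<^sub>E i\<in>I. hom C (c i) (X i))"
      and d: "d \<in> I \<rightarrow>\<^sub>E ob C" "q \<in> (\<Pi>\<^sub>E i\<in>I. hom C (d i) (X i))"
      and u: "u \<in> hom C (csum K I c) (csum K I d)"
        "cmp C (csum K I c) (csum K I d) (csum K I X) (sum_hom C K I d X q) u = sum_hom C K I c X p"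
    have ext: "c \<in> extensional I" "p \<in> extensional I" "d \<in> extensional I" "q \<in> extensional I"
      using c d by (auto simp: PiE_iff)
    have A: "(\<lambda>i\<in>I. (c i, p i)) \<in> ob ?P" and B: "(\<lambda>i\<in>I. (d i, q i)) \<in> ob ?P"
      unfolding prod_slice_ob using c d by auto
    have "u \<in> hom (slice C (csum K I X)) (on_ob (slice_sum C K I X) (\<lambda>i\<in>I. (c i, p i)))
        (on_ob (slice_sum C K I X) (\<lambda>i\<in>I. (d i, q i)))"
      unfolding slice_sum_ob[OF ext(1,2)] slice_sum_ob[OF ext(3,4)] slice_hom using u by simp
    from L[rule_format, OF A B this]
    show "\<exists>!\<phi>. (\<phi> \<in> (\<Pi>\<^sub>E i\<in>I. hom C (c i) (d i)) \<and> (\<forall>i\<in>I. cmp C (c i) (d i) (X i) (q i) (\<phi> i) = p i)) \<and>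
        sum_hom C K I c d \<phi> = u"
      unfolding prod_slice_hom slice_sum_hom[OF ext(1,3)] .
  next
    fix A B u
    assume R: ?R and A: "A \<in> ob ?P" and B: "B \<in> ob ?P"
      and u: "u \<in> hom (slice C (csum K I X)) (on_ob (slice_sum C K I X) A) (on_ob (slice_sum C K I X) B)"
    from A obtain c p where A: "A = (\<lambda>i\<in>I. (c i, p i))" and c: "c \<in> I \<rightarrow>\<^sub>E ob C" "p \<in> (\<Pi>\<^sub>E i\<in>I. hom C (c i) (X i))"
      by (rule prod_slice_obE)
    from B obtain d q where B: "B = (\<lambda>i\<in>I. (d i, q i))" and d: "d \<in> I \<rightarrow>\<^sub>E ob C" "q \<in> (\<Pi>\<^sub>E i\<in>I. hom C (d i) (X i))"
      by (rule prod_slice_obE)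
    have ext: "c \<in> extensional I" "p \<in> extensional I" "d \<in> extensional I" "q \<in> extensional I"
      using c d by (auto simp: PiE_iff)
    have u: "u \<in> hom C (csum K I c) (csum K I d)"
        "cmp C (csum K I c) (csum K I d) (csum K I X) (sum_hom C K I d X q) u = sum_hom C K I c X p"
      using u unfolding A B slice_sum_ob[OF ext(1,2)] slice_sum_ob[OF ext(3,4)] slice_hom by simp_all
    show "\<exists>!\<phi>. \<phi> \<in> hom ?P A B \<and> on_hom (slice_sum C K I X) A B \<phi> = u"
      unfolding A B prod_slice_hom slice_sum_hom[OF ext(1,3)]
      by (rule R[rule_format, OF c d u])
  qed
qed

lemma slice_sum_essentially_surjective_iff:
  assumes I: "I \<in> U" and X: "X \<in> I \<rightarrow>\<^sub>E ob C"
  shows "essentially_surjective (prod_cat I (\<lambda>i. slice C (X i))) (slice C (csum K I X)) (slice_sum C K I X) \<longleftrightarrow>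
    (\<forall>a\<in>ob C. \<forall>p\<in>hom C a (csum K I X). \<exists>c\<in>I \<rightarrow>\<^sub>E ob C. \<exists>q\<in>(\<Pi>\<^sub>E i\<in>I. hom C (c i) (X i)). \<exists>e.
      isomorphism C (csum K I c) a e \<and> cmp C (csum K I c) a (csum K I X) p e = sum_hom C K I c X q)"
    (is "?L \<longleftrightarrow> ?R")
proof -
  let ?P = "prod_cat I (\<lambda>i. slice C (X i))"
  have iso: "isomorphism (slice C (csum K I X)) (on_ob (slice_sum C K I X) (\<lambda>i\<in>I. (c i, q i))) (a, p) e \<longleftrightarrow>
      isomorphism C (csum K I c) a e \<and> cmp C (csum K I c) a (csum K I X) p e = sum_hom C K I c X q"
    if a: "a \<in> ob C" "p \<in> hom C a (csum K I X)" and c: "c \<in> I \<rightarrow>\<^sub>E ob C" "q \<in> (\<Pi>\<^sub>E i\<in>I. hom C (c i) (X i))"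
    for a p c q e
  proof -
    have ext: "c \<in> extensional I" "q \<in> extensional I" using c by (auto simp: PiE_iff)
    have "sum_hom C K I c X q \<in> hom C (csum K I c) (csum K I X)"
      by (rule sum_hom_in[OF I c(1) X]) (use c in auto)
    then show ?thesis
      unfolding slice_sum_ob[OF ext] using I X a c by (simp add: isomorphism_slice_iff)
  qed
  show ?thesis
  proof
    assume L: ?L
    show ?R
    proof (intro ballI)
      fix a p assume a: "a \<in> ob C" "p \<in> hom C a (csum K I X)"
      then have "(a, p) \<in> ob (slice C (csum K I X))" by (simp add: slice_ob)
      with L obtain A e where A: "A \<in> ob ?P"
        and e: "isomorphism (slice C (csum K I X)) (on_ob (slice_sum C K I X) A) (a, p) e"
        unfolding essentially_surjective_def by meson
      from A obtain c q where A: "A = (\<lambda>i\<in>I. (c i, q i))" and c: "c \<in> I \<rightarrow>\<^sub>E ob C" "q \<in> (\<Pi>\<^sub>E i\<in>I. hom C (c i) (X i))"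
        by (rule prod_slice_obE)
      from e iso[OF a c] c show "\<exists>c\<in>I \<rightarrow>\<^sub>E ob C. \<exists>q\<in>(\<Pi>\<^sub>E i\<in>I. hom C (c i) (X i)). \<exists>e.
          isomorphism C (csum K I c) a e \<and> cmp C (csum K I c) a (csum K I X) p e = sum_hom C K I c X q"
        unfolding A by blast
    qed
  next
    assume R: ?R
    show ?L
      unfolding essentially_surjective_def
    proof
      fix b assume b: "b \<in> ob (slice C (csum K I X))"
      obtain a p where ap: "b = (a, p)" by fastforce
      with b have a: "a \<in> ob C" "p \<in> hom C a (csum K I X)" by (simp_all add: slice_ob)
      from R[rule_format, OF a] obtain c q e where c: "c \<in> I \<rightarrow>\<^sub>E ob C" "q \<in> (\<Pi>\<^sub>E i\<in>I. hom C (c i) (X i))"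
        and e: "isomorphism C (csum K I c) a e \<and> cmp C (csum K I c) a (csum K I X) p e = sum_hom C K I c X q"
        by blast
      have "(\<lambda>i\<in>I. (c i, q i)) \<in> ob ?P" unfolding prod_slice_ob using c by auto
      with iso[OF a c] e show "\<exists>A\<in>ob ?P. \<exists>e. isomorphism (slice C (csum K I X)) (on_ob (slice_sum C K I X) A) b e"
        unfolding ap by blast
    qed
  qed
qed

section \<open>Comparison of the two conditions\<close>

text \<open>Singletons index the one-object families that test the pullback property in
  \<open>Fam\<close>; the empty set yields the initial object used for padding.\<close>

lemma empty_in_universe: "{} \<in> U"
  and singleton_in_universe: "{x} \<in> U"
proof -
  from universe have pair: "\<forall>x y. {x, y} \<in> U" and sub: "\<forall>X\<in>U. \<forall>Y. Y \<subseteq> X \<longrightarrow> Y \<in> U"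
    unfolding small_universe_def by simp_all
  from pair[rule_format, of x x] show "{x} \<in> U" by simp
  with sub show "{} \<in> U" by blast
qed

lemma ex1_unique: "\<exists>!x. P x \<Longrightarrow> P a \<Longrightarrow> P b \<Longrightarrow> a = b"
  by blast

text \<open>Restricted to the summand \<open>x\<close>, the assumption on \<open>u\<close> and
  \<open>f\<close> is the cone condition at \<open>y = f x\<close>. The pullback there gives the
  component \<open>\<phi> x\<close>, and monic coprojections give uniqueness.\<close>

lemma cartesian_imp_square_fully_faithful:
  assumes P: "cartesian_coprojections"
  shows "fully_faithful (Fam C U) square_comma square_functor"
  unfolding square_functor_fully_faithful_iff
proof (intro ballI impI)
  fix X c Y d f u
  assume X: "X \<in> U" "c \<in> X \<rightarrow>\<^sub>E ob C" and Y: "Y \<in> U" "d \<in> Y \<rightarrow>\<^sub>E ob C" and "f \<in> X \<rightarrow>\<^sub>E Y"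
    and u: "u \<in> hom C (csum K X c) (csum K Y d)"
    and eq: "cmp C (csum K X c) (csum K Y d) (copow Y) (sigma C K one (Y, d)) u
      = cmp C (csum K X c) (copow X) (copow Y) (on_hom (copower_functor C K one) X Y f) (sigma C K one (X, c))"
  then have f: "x \<in> X \<Longrightarrow> f x \<in> Y" and ob: "x \<in> X \<Longrightarrow> c x \<in> ob C" "x \<in> X \<Longrightarrow> d (f x) \<in> ob C" for x
    by auto
  have ex: "\<exists>\<phi>. \<phi> \<in> hom C (c x) (d (f x)) \<and> cmp C (c x) (d (f x)) (csum K Y d) (incl K Y d (f x)) \<phi>
      = cmp C (c x) (csum K X c) (csum K Y d) u (incl K X c x)" if x: "x \<in> X" for x
  proof (rule cartesian_lift[OF P Y f[OF x] ob(1)[OF x]])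
    show "cmp C (c x) (csum K X c) (csum K Y d) u (incl K X c x) \<in> hom C (c x) (csum K Y d)"
      using X Y u ob x by (auto intro: comp_in)
    have "cmp C (c x) (csum K Y d) (copow Y) (sigma C K one (Y, d))
        (cmp C (c x) (csum K X c) (csum K Y d) u (incl K X c x))
      = cmp C (c x) (csum K X c) (copow Y) (cmp C (csum K X c) (csum K Y d) (copow Y) (sigma C K one (Y, d)) u)
        (incl K X c x)"
      using X Y u ob x by (simp add: assoc)
    also have "\<dots> = cmp C (c x) one (copow Y) (incl K Y (points Y) (f x)) (bang (c x))"
      unfolding eq by (rule copower_sigma_incl[OF X Y(1) f x])
    finally show "cmp C (c x) (csum K Y d) (copow Y) (sigma C K one (Y, d))
        (cmp C (c x) (csum K X c) (csum K Y d) u (incl K X c x))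
      = cmp C (c x) one (copow Y) (incl K Y (points Y) (f x)) (bang (c x))" .
  qed
  define \<phi> where "\<phi> x = (SOME \<phi>. \<phi> \<in> hom C (c x) (d (f x)) \<and> cmp C (c x) (d (f x)) (csum K Y d) (incl K Y d (f x)) \<phi>
      = cmp C (c x) (csum K X c) (csum K Y d) u (incl K X c x))" for x
  have \<phi>: "\<phi> x \<in> hom C (c x) (d (f x))"
    "cmp C (c x) (d (f x)) (csum K Y d) (incl K Y d (f x)) (\<phi> x)
      = cmp C (c x) (csum K X c) (csum K Y d) u (incl K X c x)" if "x \<in> X" for x
    using someI_ex[OF ex[OF that]] unfolding \<phi>_def by simp_all
  show "\<exists>!\<phi>. \<phi> \<in> (\<Pi>\<^sub>E x\<in>X. hom C (c x) (d (f x))) \<and>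
      (\<forall>x\<in>X. cmp C (c x) (csum K X c) (csum K Y d) u (incl K X c x)
        = cmp C (c x) (d (f x)) (csum K Y d) (incl K Y d (f x)) (\<phi> x))"
  proof (rule ex1I[of _ "\<lambda>x\<in>X. \<phi> x"])
    fix \<psi> assume \<psi>: "\<psi> \<in> (\<Pi>\<^sub>E x\<in>X. hom C (c x) (d (f x))) \<and>
      (\<forall>x\<in>X. cmp C (c x) (csum K X c) (csum K Y d) u (incl K X c x)
        = cmp C (c x) (d (f x)) (csum K Y d) (incl K Y d (f x)) (\<psi> x))"
    then have "\<psi> \<in> extensional X" and \<psi>_in: "\<And>x. x \<in> X \<Longrightarrow> \<psi> x \<in> hom C (c x) (d (f x))"
      by (simp_all add: PiE_iff)
    from this(1) show "\<psi> = (\<lambda>x\<in>X. \<phi> x)"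
    proof (rule extensionalityI)
      fix x assume x: "x \<in> X"
      have "\<psi> x = \<phi> x"
        by (rule cartesian_mono[OF P Y f[OF x] ob(1)[OF x] \<psi>_in[OF x] \<phi>(1)[OF x]])
          (rule trans[OF \<psi>[THEN conjunct2, rule_format, OF x, symmetric] \<phi>(2)[OF x, symmetric]])
      with x show "\<psi> x = (\<lambda>x\<in>X. \<phi> x) x" by simp
    qed simp
  qed (simp add: \<phi>)
qed

text \<open>A morphism \<open>c \<rightarrow> \<Sum>d\<close> over the point \<open>y\<close>
  amounts to a morphism of the comma category out of the image of the one-object family
  \<open>c\<close>, with index function picking \<open>y\<close>. Its unique preimage is the wanted
  factorisation.\<close>

lemma square_fully_faithful_imp_cartesian:
  assumes ff: "fully_faithful (Fam C U) square_comma square_functor"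
  shows "cartesian_coprojections"
  unfolding cartesian_coprojections_def
proof (intro ballI impI)
  fix Y d y c g
  assume Y: "Y \<in> U" "d \<in> Y \<rightarrow>\<^sub>E ob C" "y \<in> Y" and c: "c \<in> ob C" and g: "g \<in> hom C c (csum K Y d)"
    and eq: "cmp C c (csum K Y d) (copow Y) (sigma C K one (Y, d)) g
      = cmp C c one (copow Y) (incl K Y (points Y) y) (bang c)"
  let ?S = "{y}" and ?c = "\<lambda>x\<in>{y}. c" and ?f = "\<lambda>x\<in>{y}. y"
  have S: "?S \<in> U" "?c \<in> ?S \<rightarrow>\<^sub>E ob C" using singleton_in_universe c by auto
  \<comment> \<open>The chosen coproduct of a single object need not be that object, so
    \<open>g\<close> is replaced by its extension along the coprojection.\<close>
  define u where "u = cotuple C K ?S ?c (csum K Y d) (\<lambda>_. g)"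
  have u: "u \<in> hom C (csum K ?S ?c) (csum K Y d)"
    unfolding u_def using S Y g by (intro cotuple_in) auto
  have u_incl: "cmp C c (csum K ?S ?c) (csum K Y d) u (incl K ?S ?c y) = g"
    unfolding u_def using cotuple_incl[of ?S ?c "csum K Y d" "\<lambda>_. g" y] S Y g by simp
  have incl: "incl K ?S ?c y \<in> hom C c (csum K ?S ?c)" using incl_in[OF S, of y] by simp
  have f: "?f \<in> ?S \<rightarrow>\<^sub>E Y" "\<And>x. x \<in> ?S \<Longrightarrow> ?f x \<in> Y" using Y by auto
  have "cmp C (csum K ?S ?c) (csum K Y d) (copow Y) (sigma C K one (Y, d)) u
      = cmp C (csum K ?S ?c) (copow ?S) (copow Y) (on_hom (copower_functor C K one) ?S Y ?f)
          (sigma C K one (?S, ?c))"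
  proof (rule csum_ext[OF S])
    fix x assume x: "x \<in> ?S"
    have "cmp C c (csum K ?S ?c) (copow Y)
        (cmp C (csum K ?S ?c) (csum K Y d) (copow Y) (sigma C K one (Y, d)) u) (incl K ?S ?c y)
      = cmp C c (csum K Y d) (copow Y) (sigma C K one (Y, d)) g"
      using S Y c u incl by (simp add: assoc[symmetric] u_incl)
    moreover have "cmp C (?c x) (csum K ?S ?c) (copow Y) (cmp C (csum K ?S ?c) (copow ?S) (copow Y)
          (on_hom (copower_functor C K one) ?S Y ?f) (sigma C K one (?S, ?c))) (incl K ?S ?c x)
      = cmp C (?c x) one (copow Y) (incl K Y (points Y) (?f x)) (bang (?c x))"
      by (rule copower_sigma_incl[OF S Y(1) f(2) x])
    ultimately show "cmp C (?c x) (csum K ?S ?c) (copow Y)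
        (cmp C (csum K ?S ?c) (csum K Y d) (copow Y) (sigma C K one (Y, d)) u) (incl K ?S ?c x)
      = cmp C (?c x) (csum K ?S ?c) (copow Y) (cmp C (csum K ?S ?c) (copow ?S) (copow Y)
          (on_hom (copower_functor C K one) ?S Y ?f) (sigma C K one (?S, ?c))) (incl K ?S ?c x)"
      using x eq by simp
  next
    show "copow Y \<in> ob C" using Y by simp
    show "cmp C (csum K ?S ?c) (csum K Y d) (copow Y) (sigma C K one (Y, d)) u
        \<in> hom C (csum K ?S ?c) (copow Y)"
      by (rule comp_in[OF csum_ob[OF S] csum_ob[OF Y(1,2)] csum_ob[OF Y(1) points_in] u sigma_in[OF Y(1,2)]])
    show "cmp C (csum K ?S ?c) (copow ?S) (copow Y)
          (on_hom (copower_functor C K one) ?S Y ?f) (sigma C K one (?S, ?c)) \<in> hom C (csum K ?S ?c) (copow Y)"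
      by (rule comp_in[OF csum_ob[OF S] csum_ob[OF S(1) points_in] csum_ob[OF Y(1) points_in]
            sigma_in[OF S] copower_in[OF S(1) Y(1) f(2)]])
  qed
  from ff[unfolded square_functor_fully_faithful_iff, rule_format, OF S Y(1,2) f(1) u this]
  have ex1: "\<exists>!\<phi>. \<phi> \<in> (\<Pi>\<^sub>E x\<in>{y}. hom C c (d y)) \<and> cmp C c (d y) (csum K Y d) (incl K Y d y) (\<phi> y) = g"
    by (simp add: u_incl PiE_iff eq_commute[of g])
  show "\<exists>!\<phi>. \<phi> \<in> hom C c (d y) \<and> cmp C c (d y) (csum K Y d) (incl K Y d y) \<phi> = g"
  proof (rule ex_ex1I)
    show "\<exists>\<phi>. \<phi> \<in> hom C c (d y) \<and> cmp C c (d y) (csum K Y d) (incl K Y d y) \<phi> = g"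
      using ex1 by (auto simp: PiE_iff)
    fix \<phi> \<psi> assume \<phi>: "\<phi> \<in> hom C c (d y) \<and> cmp C c (d y) (csum K Y d) (incl K Y d y) \<phi> = g"
      and \<psi>: "\<psi> \<in> hom C c (d y) \<and> cmp C c (d y) (csum K Y d) (incl K Y d y) \<psi> = g"
    \<comment> \<open>Morphisms \<open>c \<rightarrow> d y\<close> become extensional families over
      \<open>{y}\<close>, so the uniqueness in \<open>ex1\<close> carries over to them.\<close>
    have *: "(\<lambda>x\<in>{y}. \<chi>) \<in> (\<Pi>\<^sub>E x\<in>{y}. hom C c (d y)) \<and>
        cmp C c (d y) (csum K Y d) (incl K Y d y) ((\<lambda>x\<in>{y}. \<chi>) y) = g"
      if "\<chi> \<in> hom C c (d y) \<and> cmp C c (d y) (csum K Y d) (incl K Y d y) \<chi> = g" for \<chi>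
      using that by simp
    have "(\<lambda>x\<in>{y}. \<phi>) = (\<lambda>x\<in>{y}. \<psi>)"
      by (rule ex1_unique[OF ex1, OF *[OF \<phi>] *[OF \<psi>]])
    from fun_cong[OF this, of y] show "\<phi> = \<psi>" by simp
  qed
qed

text \<open>The given decomposition keeps the index set, so the identity function serves as index
  component of the isomorphism, and the copower functor sends it to an identity.\<close>

lemma decomposable_imp_square_essentially_surjective:
  assumes "decomposable_over_copowers"
  shows "essentially_surjective (Fam C U) square_comma square_functor"
  unfolding essentially_surjective_def
proof
  fix b assume b: "b \<in> ob square_comma"
  obtain a X p where eq: "b = (a, X, p)" by (metis prod.exhaust)
  with b have a: "a \<in> ob C" "X \<in> U" "p \<in> hom C a (copow X)" by (simp_all add: square_comma_ob)
  from assms[unfolded decomposable_over_copowers_def, rule_format, OF a(2,1,3)]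
  obtain c e where c: "c \<in> X \<rightarrow>\<^sub>E ob C" and e: "isomorphism C (csum K X c) a e"
    "cmp C (csum K X c) a (copow X) p e = sigma C K one (X, c)" by blast
  have "isomorphism (set_cat U) X X (\<lambda>x\<in>X. x)"
    unfolding isomorphism_def
    by (intro conjI bexI[of _ "\<lambda>x\<in>X. x"]) (auto simp: set_cat_def compose_def)
  moreover have "on_hom (copower_functor C K one) X X (\<lambda>x\<in>X. x) = idn C (copow X)"
    using functor_id[OF copower_is_functor, of X] a by (simp add: set_cat_def copower_functor_def)
  ultimately have "isomorphism square_comma (on_ob square_functor (X, c)) b (e, \<lambda>x\<in>X. x)"
    unfolding eq square_functor_ob using a c e
    by (simp add: isomorphism_square_comma_iff id_left)
  then show "\<exists>F\<in>ob (Fam C U). \<exists>e. isomorphism square_comma (on_ob square_functor F) b e"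
    using a c by (intro bexI[of _ "(X, c)"] exI[of _ "(e, \<lambda>x\<in>X. x)"]) (simp_all add: Fam_ob)
qed

text \<open>
  A decomposition over the comma category may come indexed by a set \<open>J\<close> that is merely in
  bijection with \<open>X\<close>; reindexing along the bijection is an isomorphism of families.
\<close>

lemma square_essentially_surjective_imp_decomposable:
  assumes "essentially_surjective (Fam C U) square_comma square_functor"
  shows "decomposable_over_copowers"
  unfolding decomposable_over_copowers_def
proof (intro ballI)
  fix X a p assume a: "X \<in> U" "a \<in> ob C" "p \<in> hom C a (copow X)"
  then have apX: "(a, X, p) \<in> ob square_comma" by (simp add: square_comma_ob)
  with assms obtain F i where F: "F \<in> ob (Fam C U)"
    and i: "isomorphism square_comma (on_ob square_functor F) (a, X, p) i"
    unfolding essentially_surjective_def by meson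
  obtain J c e g where eqs: "F = (J, c)" "i = (e, g)" by (metis prod.exhaust)
  have J: "J \<in> U" "c \<in> J \<rightarrow>\<^sub>E ob C" using F by (simp_all add: eqs Fam_ob)
  have "isomorphism (set_cat U) J X g"
    using i J a by (simp add: eqs square_functor_ob isomorphism_square_comma_iff)
  then obtain g' where g: "g \<in> J \<rightarrow>\<^sub>E X" "g' \<in> X \<rightarrow>\<^sub>E J"
    and inv: "compose J g' g = (\<lambda>j\<in>J. j)" "compose X g g' = (\<lambda>x\<in>X. x)"
    unfolding isomorphism_def by (auto simp: set_cat_def)
  have g'g: "g' (g j) = j" if "j \<in> J" for j using fun_cong[OF inv(1), of j] that by (simp add: compose_def)
  have gg': "g (g' x) = x" if "x \<in> X" for x using fun_cong[OF inv(2), of x] that by (simp add: compose_def)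
  let ?c = "\<lambda>x\<in>X. c (g' x)"
  have c: "?c \<in> X \<rightarrow>\<^sub>E ob C" using J g by auto
  have cj: "c j \<in> ob C" if "j \<in> J" for j using J that by auto
  let ?r = "(g', \<lambda>x\<in>X. idn C (c (g' x)))" and ?r' = "(g, \<lambda>j\<in>J. idn C (c j))"
  have g_mem: "j \<in> J \<Longrightarrow> g j \<in> X" and g'_mem: "x \<in> X \<Longrightarrow> g' x \<in> J" for j x using g by auto
  have r: "isomorphism (Fam C U) (X, ?c) (J, c) ?r"
    unfolding isomorphism_def
  proof (intro conjI bexI[of _ ?r'])
    show "?r \<in> hom (Fam C U) (X, ?c) (J, c)" "?r' \<in> hom (Fam C U) (J, c) (X, ?c)"
      unfolding Fam_hom using g g_mem g'_mem g'g cj by (auto intro!: id_in)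
    show "cmp (Fam C U) (X, ?c) (J, c) (X, ?c) ?r' ?r = idn (Fam C U) (X, ?c)"
      using inv g_mem g'_mem gg' cj
      by (auto simp: Fam_def id_left id_in intro!: restrict_ext)
    show "cmp (Fam C U) (J, c) (X, ?c) (J, c) ?r ?r' = idn (Fam C U) (J, c)"
      using inv g_mem g'_mem g'g cj
      by (auto simp: Fam_def id_left id_in intro!: restrict_ext)
  qed
  have Fam: "(X, ?c) \<in> ob (Fam C U)" "(J, c) \<in> ob (Fam C U)" using a J c by (simp_all add: Fam_ob)
  have sq: "is_functor (Fam C U) square_comma square_functor"
    by (rule comma_functor_is_functor[OF square_is_lax])
  have comma: "category square_comma"
    by (rule category_comma[OF category category_set_cat category id_functor_is_functor copower_is_functor])
  \<comment> \<open>Reindexing followed by \<open>i\<close> has index component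
    \<open>compose X g g'\<close>, the identity of \<open>X\<close>; the first component of the
    composite is therefore an isomorphism over \<open>X * 1\<close>.\<close>
  have "isomorphism square_comma (on_ob square_functor (X, ?c)) (a, X, p)
      (cmp square_comma (on_ob square_functor (X, ?c)) (on_ob square_functor (J, c)) (a, X, p) (e, g)
        (on_hom square_functor (X, ?c) (J, c) ?r))"
    by (rule isomorphism_comp[OF comma functor_ob[OF sq Fam(1)] functor_ob[OF sq Fam(2)] apX
          isomorphism_functor[OF sq Fam r] i[unfolded eqs]])
  then obtain e' where "isomorphism square_comma (on_ob square_functor (X, ?c)) (a, X, p) (e', compose X g g')"
    by (simp add: square_functor_ob square_functor_hom) (simp add: comma_def set_cat_def)
  then have e': "isomorphism C (csum K X ?c) a e'"
    "cmp C (csum K X ?c) a (copow X) p e' = cmp C (csum K X ?c) (copow X) (copow X)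
      (on_hom (copower_functor C K one) X X (\<lambda>x\<in>X. x)) (sigma C K one (X, ?c))"
    unfolding square_functor_ob inv using a c by (simp_all add: isomorphism_square_comma_iff)
  have "on_hom (copower_functor C K one) X X (\<lambda>x\<in>X. x) = idn C (copow X)"
    using functor_id[OF copower_is_functor, of X] a by (simp add: set_cat_def copower_functor_def)
  with e' have "cmp C (csum K X ?c) a (copow X) p e' = sigma C K one (X, ?c)"
    using a c by (simp add: id_left)
  with c e'(1) show "\<exists>c\<in>X \<rightarrow>\<^sub>E ob C. \<exists>e. isomorphism C (csum K X c) a e \<and>
      cmp C (csum K X c) a (copow X) p e = sigma C K one (X, c)"
    by blast
qed

text \<open>The square is always lax by \<open>square_is_lax\<close>, so the equivalence alone is at
  stake.\<close>

lemma comma_diagram_iff: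
  "comma_diagram (Fam C U) C (set_cat U) C (sum_functor C K) index_functor id_functor
      (copower_functor C K one) (sigma C K one)
    \<longleftrightarrow> cartesian_coprojections \<and> decomposable_over_copowers"
proof -
  have "equivalence (Fam C U) square_comma square_functor \<longleftrightarrow>
      fully_faithful (Fam C U) square_comma square_functor \<and>
      essentially_surjective (Fam C U) square_comma square_functor"
    by (intro equivalence_iff category_Fam category comma_functor_is_functor square_is_lax category_comma
        category_set_cat id_functor_is_functor copower_is_functor)
  then show ?thesis
    unfolding comma_diagram_def
    using square_is_lax cartesian_imp_square_fully_faithful square_fully_faithful_imp_cartesian
      decomposable_imp_square_essentially_surjective square_essentially_surjective_imp_decomposable
    by blast
qed

text \<open>Composing with \<open>sigma\<close> for \<open>X\<close> turns a morphism over
  \<open>\<Sum>X\<close> into one over \<open>I * 1\<close>, where the pullback property for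
  \<open>d\<close> yields the components. That these commute with the structure maps into
  \<open>X i\<close> is checked after the coprojection of \<open>X i\<close>, which is
  monic.\<close>

lemma cartesian_imp_slice_sum_fully_faithful:
  assumes P: "cartesian_coprojections" and I: "I \<in> U" and X: "X \<in> I \<rightarrow>\<^sub>E ob C"
  shows "fully_faithful (prod_cat I (\<lambda>i. slice C (X i))) (slice C (csum K I X)) (slice_sum C K I X)"
  unfolding slice_sum_fully_faithful_iff
proof (intro ballI impI)
  fix c p d q u
  assume c: "c \<in> I \<rightarrow>\<^sub>E ob C" and d: "d \<in> I \<rightarrow>\<^sub>E ob C"
    and "p \<in> (\<Pi>\<^sub>E i\<in>I. hom C (c i) (X i))" "q \<in> (\<Pi>\<^sub>E i\<in>I. hom C (d i) (X i))"
    and u: "u \<in> hom C (csum K I c) (csum K I d)"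
    and eq: "cmp C (csum K I c) (csum K I d) (csum K I X) (sum_hom C K I d X q) u = sum_hom C K I c X p"
  then have p: "\<And>i. i \<in> I \<Longrightarrow> p i \<in> hom C (c i) (X i)" and q: "\<And>i. i \<in> I \<Longrightarrow> q i \<in> hom C (d i) (X i)"
    by auto
  have ob: "c i \<in> ob C" "d i \<in> ob C" "X i \<in> ob C" if "i \<in> I" for i using c d X that by auto
  note Sq = sum_hom_in[OF I d X q] sum_hom_incl[OF I d X q]
    and Sp = sum_hom_in[OF I c X p] sum_hom_incl[OF I c X p]
  let ?ui = "\<lambda>i. cmp C (c i) (csum K I c) (csum K I d) u (incl K I c i)"
  have "cmp C (csum K I c) (csum K I d) (copow I) (sigma C K one (I, d)) u
      = cmp C (csum K I c) (csum K I d) (copow I)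
        (cmp C (csum K I d) (csum K I X) (copow I) (sigma C K one (I, X)) (sum_hom C K I d X q)) u"
    using sigma_sum_hom[OF I d X q] by simp
  also have "\<dots> = cmp C (csum K I c) (csum K I X) (copow I) (sigma C K one (I, X)) (sum_hom C K I c X p)"
    using I c d X u Sq(1) by (simp add: assoc[symmetric] eq)
  also have "\<dots> = sigma C K one (I, c)"
    by (rule sigma_sum_hom[OF I c X p])
  finally have \<sigma>u: "cmp C (csum K I c) (csum K I d) (copow I) (sigma C K one (I, d)) u = sigma C K one (I, c)" .
  have "\<exists>\<phi>. \<phi> \<in> hom C (c i) (d i) \<and> cmp C (c i) (d i) (csum K I d) (incl K I d i) \<phi> = ?ui i"
    if i: "i \<in> I" for i
  proof (rule cartesian_lift[OF P I d i ob(1)[OF i]])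
    show "?ui i \<in> hom C (c i) (csum K I d)"
      using I c d u ob i by (auto intro: comp_in)
    show "cmp C (c i) (csum K I d) (copow I) (sigma C K one (I, d)) (?ui i)
        = cmp C (c i) one (copow I) (incl K I (points I) i) (bang (c i))"
      using I c d u ob i by (simp add: assoc \<sigma>u sigma_incl)
  qed
  then obtain \<phi> where \<phi>: "\<And>i. i \<in> I \<Longrightarrow> \<phi> i \<in> hom C (c i) (d i)"
    "\<And>i. i \<in> I \<Longrightarrow> cmp C (c i) (d i) (csum K I d) (incl K I d i) (\<phi> i) = ?ui i"
    by metis
  have q\<phi>: "cmp C (c i) (d i) (X i) (q i) (\<phi> i) = p i" if i: "i \<in> I" for i
  proof (rule cartesian_mono[OF P I X i ob(1)[OF i]])
    show "cmp C (c i) (d i) (X i) (q i) (\<phi> i) \<in> hom C (c i) (X i)"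
      using ob[OF i] \<phi>(1)[OF i] q[OF i] by (auto intro: comp_in)
    have "cmp C (c i) (X i) (csum K I X) (incl K I X i) (cmp C (c i) (d i) (X i) (q i) (\<phi> i))
        = cmp C (c i) (d i) (csum K I X)
          (cmp C (d i) (csum K I d) (csum K I X) (sum_hom C K I d X q) (incl K I d i)) (\<phi> i)"
      using I X ob[OF i] \<phi>(1)[OF i] q[OF i] i Sq(2)[OF _ i] by (simp add: assoc)
    also have "\<dots> = cmp C (c i) (csum K I d) (csum K I X) (sum_hom C K I d X q) (?ui i)"
      using I X d ob[OF i] \<phi>[OF i] Sq(1) i by (simp add: assoc[symmetric])
    also have "\<dots> = cmp C (c i) (csum K I c) (csum K I X) (sum_hom C K I c X p) (incl K I c i)"
      using I X c d ob[OF i] u Sq(1) i by (simp add: assoc eq)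
    also have "\<dots> = cmp C (c i) (X i) (csum K I X) (incl K I X i) (p i)"
      by (rule Sp(2)[OF _ i])
    finally show "cmp C (c i) (X i) (csum K I X) (incl K I X i) (cmp C (c i) (d i) (X i) (q i) (\<phi> i))
        = cmp C (c i) (X i) (csum K I X) (incl K I X i) (p i)" .
  qed (rule p[OF i])
  show "\<exists>!\<phi>. (\<phi> \<in> (\<Pi>\<^sub>E i\<in>I. hom C (c i) (d i)) \<and> (\<forall>i\<in>I. cmp C (c i) (d i) (X i) (q i) (\<phi> i) = p i)) \<and>
      sum_hom C K I c d \<phi> = u"
  proof (rule ex1I[of _ "\<lambda>i\<in>I. \<phi> i"])
    show "((\<lambda>i\<in>I. \<phi> i) \<in> (\<Pi>\<^sub>E i\<in>I. hom C (c i) (d i)) \<and>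
        (\<forall>i\<in>I. cmp C (c i) (d i) (X i) (q i) ((\<lambda>i\<in>I. \<phi> i) i) = p i)) \<and>
        sum_hom C K I c d (\<lambda>i\<in>I. \<phi> i) = u"
      using \<phi> q\<phi> sum_hom_eq_iff[OF I c d _ u, of "\<lambda>i\<in>I. \<phi> i"] by simp
    fix \<psi>
    assume *: "(\<psi> \<in> (\<Pi>\<^sub>E i\<in>I. hom C (c i) (d i)) \<and> (\<forall>i\<in>I. cmp C (c i) (d i) (X i) (q i) (\<psi> i) = p i)) \<and>
        sum_hom C K I c d \<psi> = u"
    then have \<psi>: "\<psi> \<in> extensional I" "\<And>i. i \<in> I \<Longrightarrow> \<psi> i \<in> hom C (c i) (d i)" by (auto simp: PiE_iff)
    from \<psi>(1) show "\<psi> = (\<lambda>i\<in>I. \<phi> i)"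
    proof (rule extensionalityI)
      fix i assume i: "i \<in> I"
      have "\<psi> i = \<phi> i"
        by (rule cartesian_mono[OF P I d i ob(1)[OF i] \<psi>(2)[OF i] \<phi>(1)[OF i]])
          (use * sum_hom_incl[OF I c d \<psi>(2), of i] \<phi>(2)[OF i] i in simp)
      with i show "\<psi> i = (\<lambda>i\<in>I. \<phi> i) i" by simp
    qed simp
  qed
qed

text \<open>A decomposition of \<open>a\<close> over \<open>I * 1\<close> provides the summands
  \<open>c i\<close> but no morphisms \<open>c i \<rightarrow> X i\<close>; these come from the
  pullback property for the family \<open>X\<close>.\<close>

lemma cartesian_decomposable_imp_slice_sum_essentially_surjective:
  assumes P: "cartesian_coprojections" and S: "decomposable_over_copowers" and I: "I \<in> U" and X: "X \<in> I \<rightarrow>\<^sub>E ob C"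
  shows "essentially_surjective (prod_cat I (\<lambda>i. slice C (X i))) (slice C (csum K I X)) (slice_sum C K I X)"
  unfolding slice_sum_essentially_surjective_iff[OF I X]
proof (intro ballI)
  fix a p assume a: "a \<in> ob C" and p: "p \<in> hom C a (csum K I X)"
  let ?\<sigma> = "sigma C K one (I, X)"
  have "cmp C a (csum K I X) (copow I) ?\<sigma> p \<in> hom C a (copow I)"
    using I X a p by (auto intro: comp_in)
  from S[unfolded decomposable_over_copowers_def, rule_format, OF I a this]
  obtain c e where c: "c \<in> I \<rightarrow>\<^sub>E ob C" and e: "isomorphism C (csum K I c) a e"
    and eq: "cmp C (csum K I c) a (copow I) (cmp C a (csum K I X) (copow I) ?\<sigma> p) e = sigma C K one (I, c)"
    by blast
  have e_in: "e \<in> hom C (csum K I c) a" by (rule isomorphism_in_hom[OF e])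
  let ?pe = "cmp C (csum K I c) a (csum K I X) p e"
  have pe: "?pe \<in> hom C (csum K I c) (csum K I X)"
    using I X c a p e_in by (auto intro: comp_in)
  \<comment> \<open>As \<open>sigma\<close> for \<open>X\<close> after \<open>?pe\<close> is
    \<open>sigma\<close> for \<open>c\<close>, each restriction of \<open>?pe\<close> to
    \<open>c i\<close> satisfies the cone condition at \<open>i\<close>.\<close>
  have \<sigma>pe: "cmp C (csum K I c) (csum K I X) (copow I) ?\<sigma> ?pe = sigma C K one (I, c)"
    using I X c a p e_in eq by (simp add: assoc)
  have ob: "c i \<in> ob C" if "i \<in> I" for i using c that by auto
  have "\<exists>\<phi>. \<phi> \<in> hom C (c i) (X i) \<and> cmp C (c i) (X i) (csum K I X) (incl K I X i) \<phi>
      = cmp C (c i) (csum K I c) (csum K I X) ?pe (incl K I c i)" if i: "i \<in> I" for i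
  proof (rule cartesian_lift[OF P I X i ob[OF i]])
    show "cmp C (c i) (csum K I c) (csum K I X) ?pe (incl K I c i) \<in> hom C (c i) (csum K I X)"
      using I X c ob i pe by (auto intro: comp_in)
    have "cmp C (c i) (csum K I X) (copow I) ?\<sigma> (cmp C (c i) (csum K I c) (csum K I X) ?pe (incl K I c i))
        = cmp C (c i) (csum K I c) (copow I) (cmp C (csum K I c) (csum K I X) (copow I) ?\<sigma> ?pe) (incl K I c i)"
      by (rule assoc) (use I X c ob i pe in auto)
    then show "cmp C (c i) (csum K I X) (copow I) ?\<sigma> (cmp C (c i) (csum K I c) (csum K I X) ?pe (incl K I c i))
        = cmp C (c i) one (copow I) (incl K I (points I) i) (bang (c i))"
      using I c i by (simp only: \<sigma>pe sigma_incl)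
  qed
  then obtain q where q: "\<And>i. i \<in> I \<Longrightarrow> q i \<in> hom C (c i) (X i)"
    "\<And>i. i \<in> I \<Longrightarrow> cmp C (c i) (X i) (csum K I X) (incl K I X i) (q i)
      = cmp C (c i) (csum K I c) (csum K I X) ?pe (incl K I c i)"
    by metis
  have "sum_hom C K I c X (\<lambda>i\<in>I. q i) = ?pe"
    using q sum_hom_eq_iff[OF I c X _ pe, of "\<lambda>i\<in>I. q i"] by simp
  then show "\<exists>c\<in>I \<rightarrow>\<^sub>E ob C. \<exists>q\<in>\<Pi>\<^sub>E i\<in>I. hom C (c i) (X i). \<exists>e. isomorphism C (csum K I c) a e \<and>
      cmp C (csum K I c) a (csum K I X) p e = sum_hom C K I c X q"
    using c e q(1) by (intro bexI[of _ c] bexI[of _ "\<lambda>i\<in>I. q i"] exI[of _ e]) auto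
qed

text \<open>Structure maps into the terminal object are forced, so over \<open>points I\<close> the
  slice sum sends a family \<open>c\<close> to its coproduct with \<open>sigma\<close> as structure
  map.\<close>

lemma hom_points_eq:
  assumes "c \<in> I \<rightarrow>\<^sub>E ob C" "p \<in> (\<Pi>\<^sub>E i\<in>I. hom C (c i) (points I i))"
  shows "p = (\<lambda>i\<in>I. bang (c i))"
  by (rule extensionalityI[of _ I]) (use assms in \<open>auto simp: PiE_iff intro!: bang_unique\<close>)

lemma bang_hom_points: "c \<in> I \<rightarrow>\<^sub>E ob C \<Longrightarrow> (\<lambda>i\<in>I. bang (c i)) \<in> (\<Pi>\<^sub>E i\<in>I. hom C (c i) (points I i))"
  by (auto simp: PiE_iff)

lemma slice_sum_essentially_surjective_imp_decomposable:
  assumes "\<And>I. I \<in> U \<Longrightarrow> essentially_surjective (prod_cat I (\<lambda>i. slice C (points I i)))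
    (slice C (copow I)) (slice_sum C K I (points I))"
  shows "decomposable_over_copowers"
  unfolding decomposable_over_copowers_def
proof (intro ballI)
  fix I a p assume I: "I \<in> U" and a: "a \<in> ob C" "p \<in> hom C a (copow I)"
  from assms[OF I, unfolded slice_sum_essentially_surjective_iff[OF I points_in], rule_format, OF a]
  obtain c q e where c: "c \<in> I \<rightarrow>\<^sub>E ob C" and q: "q \<in> (\<Pi>\<^sub>E i\<in>I. hom C (c i) (points I i))"
    and e: "isomorphism C (csum K I c) a e" "cmp C (csum K I c) a (copow I) p e = sum_hom C K I c (points I) q"
    by blast
  from e(2) have "cmp C (csum K I c) a (copow I) p e = sigma C K one (I, c)"
    unfolding hom_points_eq[OF c q] sigma_eq_sum_hom .
  with c e(1) show "\<exists>c\<in>I \<rightarrow>\<^sub>E ob C. \<exists>e. isomorphism C (csum K I c) a e \<and>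
      cmp C (csum K I c) a (copow I) p e = sigma C K one (I, c)"
    by blast
qed

text \<open>
  A morphism \<open>c \<rightarrow> \<Sum>d\<close> over the point \<open>y\<close> extends to a morphism of coproducts over \<open>Y * 1\<close>
  once the single object \<open>c\<close> is padded with initial objects at the other indices.
\<close>

lemma slice_sum_fully_faithful_imp_cartesian:
  assumes ff: "\<And>I. I \<in> U \<Longrightarrow> fully_faithful (prod_cat I (\<lambda>i. slice C (points I i)))
    (slice C (copow I)) (slice_sum C K I (points I))"
  shows "cartesian_coprojections"
  unfolding cartesian_coprojections_def
proof (intro ballI impI)
  fix Y d y c g
  assume Y: "Y \<in> U" and d: "d \<in> Y \<rightarrow>\<^sub>E ob C" and y: "y \<in> Y" and c: "c \<in> ob C" and g: "g \<in> hom C c (csum K Y d)"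
    and eq: "cmp C c (csum K Y d) (copow Y) (sigma C K one (Y, d)) g
      = cmp C c one (copow Y) (incl K Y (points Y) y) (bang c)"
  \<comment> \<open>This is the one member of \<open>{} \<rightarrow>\<^sub>E ob C\<close>,
    extensional families being \<open>undefined\<close> off their index set. Its coproduct
    \<open>zero\<close> is initial.\<close>
  let ?none = "\<lambda>x::'i. undefined"
  have empty: "{} \<in> U" "?none \<in> {} \<rightarrow>\<^sub>E ob C" using empty_in_universe by auto
  define zero where "zero = csum K {} ?none"
  define zm where "zm z = cotuple C K {} ?none z ?none" for z
  have zero: "zero \<in> ob C" unfolding zero_def using empty by (rule csum_ob)
  have zm: "zm z \<in> hom C zero z" if "z \<in> ob C" for z
    unfolding zero_def zm_def using empty that by (intro cotuple_in) auto
  have zero_unique: "u = v" if "z \<in> ob C" "u \<in> hom C zero z" "v \<in> hom C zero z" for u v z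
    using csum_ext[OF empty that(1), of u v] that unfolding zero_def by simp
  define c' where "c' = (\<lambda>x\<in>Y. if x = y then c else zero)"
  have c': "c' \<in> Y \<rightarrow>\<^sub>E ob C" unfolding c'_def using c zero by auto
  have c'y: "c' y = c" and c'x: "x \<in> Y \<Longrightarrow> x \<noteq> y \<Longrightarrow> c' x = zero" for x using y by (auto simp: c'_def)
  have ob: "d x \<in> ob C" "c' x \<in> ob C" if "x \<in> Y" for x using d c' that by auto
  \<comment> \<open>Away from \<open>y\<close> the legs start at the initial object, so lying over
    \<open>Y * 1\<close> is a condition at \<open>y\<close> alone, namely the one assumed of
    \<open>g\<close>.\<close>
  define v where "v = cotuple C K Y c' (csum K Y d) (\<lambda>x. if x = y then g else zm (csum K Y d))"
  have legs: "(if x = y then g else zm (csum K Y d)) \<in> hom C (c' x) (csum K Y d)" if "x \<in> Y" for x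
    using that g zm Y d c'y c'x by auto
  have v: "v \<in> hom C (csum K Y c') (csum K Y d)"
    unfolding v_def by (rule cotuple_in[OF Y c' csum_ob[OF Y d] legs])
  have v_incl: "cmp C (c' x) (csum K Y c') (csum K Y d) v (incl K Y c' x)
      = (if x = y then g else zm (csum K Y d))" if "x \<in> Y" for x
    unfolding v_def by (rule cotuple_incl[OF Y c' csum_ob[OF Y d] legs that])
  have v_sigma: "cmp C (csum K Y c') (csum K Y d) (copow Y) (sigma C K one (Y, d)) v = sigma C K one (Y, c')"
  proof (rule csum_ext[OF Y c'])
    fix x assume x: "x \<in> Y"
    let ?l = "cmp C (c' x) (csum K Y c') (copow Y)
      (cmp C (csum K Y c') (csum K Y d) (copow Y) (sigma C K one (Y, d)) v) (incl K Y c' x)"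
    have in_hom: "cmp C (csum K Y c') (csum K Y d) (copow Y) (sigma C K one (Y, d)) v
        \<in> hom C (csum K Y c') (copow Y)"
      using Y d c' v by (auto intro: comp_in)
    show "?l = cmp C (c' x) (csum K Y c') (copow Y) (sigma C K one (Y, c')) (incl K Y c' x)"
    proof (cases "x = y")
      case True
      have "?l = cmp C (c' x) (csum K Y d) (copow Y) (sigma C K one (Y, d))
          (cmp C (c' x) (csum K Y c') (csum K Y d) v (incl K Y c' x))"
        by (rule assoc[symmetric]) (use Y d c' v ob x in auto)
      also have "\<dots> = cmp C c (csum K Y d) (copow Y) (sigma C K one (Y, d)) g"
        unfolding v_incl[OF x] using True by (simp add: c'y)
      finally show ?thesis
        using sigma_incl[OF Y c' x] True by (simp add: eq c'y)
    next
      case False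
      show ?thesis
        by (rule zero_unique[of "copow Y"])
          (use Y c' ob x in_hom c'x[OF x False] in \<open>auto intro!: comp_in simp flip: c'x[OF x False]\<close>)
    qed
  qed (use Y d c' v in \<open>auto intro: comp_in\<close>)
  have "cmp C (csum K Y c') (csum K Y d) (copow Y) (sum_hom C K Y d (points Y) (\<lambda>x\<in>Y. bang (d x))) v
      = sum_hom C K Y c' (points Y) (\<lambda>x\<in>Y. bang (c' x))"
    using v_sigma unfolding sigma_eq_sum_hom .
  note ff' = ff[OF Y, unfolded slice_sum_fully_faithful_iff, rule_format, OF c' bang_hom_points[OF c']
      d bang_hom_points[OF d] v this]
  show "\<exists>!\<phi>. \<phi> \<in> hom C c (d y) \<and> cmp C c (d y) (csum K Y d) (incl K Y d y) \<phi> = g"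
  proof (rule ex_ex1I)
    from ff' obtain \<phi> where "\<phi> \<in> (\<Pi>\<^sub>E x\<in>Y. hom C (c' x) (d x))" and sum: "sum_hom C K Y c' d \<phi> = v"
      by blast
    then have \<phi>: "\<And>x. x \<in> Y \<Longrightarrow> \<phi> x \<in> hom C (c' x) (d x)" by auto
    show "\<exists>\<phi>. \<phi> \<in> hom C c (d y) \<and> cmp C c (d y) (csum K Y d) (incl K Y d y) \<phi> = g"
      using sum_hom_incl[OF Y c' d \<phi> y] \<phi>[OF y] v_incl[OF y] by (auto simp: sum c'y)
  next
    fix \<phi> \<psi> assume \<phi>: "\<phi> \<in> hom C c (d y) \<and> cmp C c (d y) (csum K Y d) (incl K Y d y) \<phi> = g"
      and \<psi>: "\<psi> \<in> hom C c (d y) \<and> cmp C c (d y) (csum K Y d) (incl K Y d y) \<psi> = g"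
    \<comment> \<open>For uniqueness, a factorisation \<open>\<chi>\<close> of \<open>g\<close> is
      padded by morphisms out of \<open>zero\<close> to a family with sum \<open>v\<close>. Two
      factorisations thus give two preimages of \<open>v\<close>; these coincide and are compared at
      \<open>y\<close>.\<close>
    define ext where "ext \<chi> = (\<lambda>x\<in>Y. if x = y then \<chi> else zm (d x))" for \<chi>
    have "(ext \<chi> \<in> (\<Pi>\<^sub>E x\<in>Y. hom C (c' x) (d x)) \<and>
        (\<forall>x\<in>Y. cmp C (c' x) (d x) (points Y x) ((\<lambda>x\<in>Y. bang (d x)) x) (ext \<chi> x) = (\<lambda>x\<in>Y. bang (c' x)) x)) \<and>
        sum_hom C K Y c' d (ext \<chi>) = v"
      if \<chi>: "\<chi> \<in> hom C c (d y)" "cmp C c (d y) (csum K Y d) (incl K Y d y) \<chi> = g" for \<chi>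
    proof (intro conjI ballI)
      have ext: "ext \<chi> x \<in> hom C (c' x) (d x)" if "x \<in> Y" for x
        unfolding ext_def using that \<chi> zm ob c'y c'x by auto
      then show "ext \<chi> \<in> (\<Pi>\<^sub>E x\<in>Y. hom C (c' x) (d x))" by (auto simp: ext_def)
      show "cmp C (c' x) (d x) (points Y x) ((\<lambda>x\<in>Y. bang (d x)) x) (ext \<chi> x) = (\<lambda>x\<in>Y. bang (c' x)) x"
        if x: "x \<in> Y" for x
        using x ext[OF x] ob[OF x] by (auto intro!: bang_unique comp_in)
      have "\<forall>x\<in>Y. cmp C (c' x) (csum K Y c') (csum K Y d) v (incl K Y c' x)
          = cmp C (c' x) (d x) (csum K Y d) (incl K Y d x) (ext \<chi> x)"
      proof
        fix x assume x: "x \<in> Y"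
        have *: "cmp C (c' x) (d x) (csum K Y d) (incl K Y d x) (ext \<chi> x) \<in> hom C (c' x) (csum K Y d)"
          using Y d ob[OF x] ext[OF x] x by (auto intro: comp_in)
        show "cmp C (c' x) (csum K Y c') (csum K Y d) v (incl K Y c' x)
          = cmp C (c' x) (d x) (csum K Y d) (incl K Y d x) (ext \<chi> x)"
        proof (cases "x = y")
          case True
          then show ?thesis unfolding v_incl[OF x] using x \<chi> by (simp add: ext_def c'y)
        next
          case False
          with * show ?thesis
            unfolding v_incl[OF x] using zero_unique[OF csum_ob[OF Y d] zm[OF csum_ob[OF Y d]]]
            by (simp add: c'x[OF x False])
        qed
      qed
      then show "sum_hom C K Y c' d (ext \<chi>) = v"
        using sum_hom_eq_iff[OF Y c' d ext v] by simp
    qed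
    with \<phi> \<psi> ff' have "ext \<phi> = ext \<psi>" by blast
    from fun_cong[OF this, of y] show "\<phi> = \<psi>" using y by (simp add: ext_def)
  qed
qed

lemma extensive_iff: "extensive C U K \<longleftrightarrow> cartesian_coprojections \<and> decomposable_over_copowers"
proof -
  have eqv: "equivalence (prod_cat I (\<lambda>i. slice C (X i))) (slice C (csum K I X)) (slice_sum C K I X) \<longleftrightarrow>
      fully_faithful (prod_cat I (\<lambda>i. slice C (X i))) (slice C (csum K I X)) (slice_sum C K I X) \<and>
      essentially_surjective (prod_cat I (\<lambda>i. slice C (X i))) (slice C (csum K I X)) (slice_sum C K I X)"
    if "I \<in> U" "X \<in> I \<rightarrow>\<^sub>E ob C" for I X
    using that by (intro equivalence_iff category_prod_cat category_slice category slice_sum_is_functor) auto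
  show ?thesis
  proof
    assume "extensive C U K"
    then have "fully_faithful (prod_cat I (\<lambda>i. slice C (points I i))) (slice C (copow I)) (slice_sum C K I (points I)) \<and>
      essentially_surjective (prod_cat I (\<lambda>i. slice C (points I i))) (slice C (copow I)) (slice_sum C K I (points I))"
      if "I \<in> U" for I
      unfolding extensive_def by (intro eqv[THEN iffD1] that points_in) (use that points_in in blast)
    then show "cartesian_coprojections \<and> decomposable_over_copowers"
      by (intro conjI slice_sum_fully_faithful_imp_cartesian slice_sum_essentially_surjective_imp_decomposable) auto
  next
    assume "cartesian_coprojections \<and> decomposable_over_copowers"
    then show "extensive C U K"
      unfolding extensive_def
      by (intro ballI eqv[THEN iffD2] conjI cartesian_imp_slice_sum_fully_faithful
          cartesian_decomposable_imp_slice_sum_essentially_surjective) auto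
  qed
qed

end

theorem lemma7p1:
  fixes C :: "('o, 'm) cat"
    and U :: "'i set set"
    and K :: "('i, 'o, 'm) coproduct_choice"
    and one :: 'o
  assumes "small_universe U"
    and "category C"
    and "has_coproducts C U K"
    and "terminal C one"
  shows "comma_diagram (Fam C U) C (set_cat U) C
           (sum_functor C K) index_functor id_functor (copower_functor C K one)
           (sigma C K one)
         \<longleftrightarrow> extensive C U K"
proof -
  interpret coproduct_category C U K one
    using assms by unfold_locales
  show ?thesis using comma_diagram_iff extensive_iff by blast
qed

end
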